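(* Let $\Sigma$ be a one-sorted signature. A cell $\langle s,u,v,t\rangle$ (with $s\colon o_1\to o_0$, $u\colon o_2\to o_0$, $v\colon o_3\to o_1$, $t\colon o_3\to o_2$ arrows of $\mathbf{Th}[\Sigma]$) is generated by the pullback basis $\mathcal{B}(\Sigma)$ if and only if $(o_3,v,t)$ is a pullback of $s$ and $u$ in $\mathbf{Th}[\Sigma]$. That is, $\mathcal{B}(\Sigma)$ generates all and only the pullback squares of $\mathbf{Th}[\Sigma]$.
   Context: $\mathbf{Th}[\Sigma]$ is the free algebraic (Lawvere) theory of $\Sigma$: objects are natural numbers $\underline{n}$; an arrow $\underline{n}\to\underline{m}$ is an $m$-tuple of $\Sigma$-terms over $x_1,\dots,x_n$ (equivalently a substitution); composition $\alpha;\beta$ (diagrammatic, $\alpha$ first) is substitution; $\otimes$ is juxtaposition on disjoint variable blocks. An $n$-ary $f\in\Sigma$ is the arrow $f\colon\underline{n}\to\underline{1}$. Symmetry $\gamma_{\underline{n},\underline{m}}=\langle x_{n+1},\dots,x_{n+m},x_1,\dots,x_n\rangle$; duplicator $\nabla_{\underline{n}}=\langle x_1,\dots,x_n,x_1,\dots,x_n\rangle\colon\underline{n}\to\underline{2n}$. A pullback of $s\colon o_1\to o_0$ and $u\colon o_2\to o_0$ is an object $o_3$ with $v\colon o_3\to o_1$, $t\colon o_3\to o_2$, $t;u=v;s$, such that every other such pair factors uniquely through $(v,t)$. A cell is a quadruple $\langle s,u,v,t\rangle$ of arrows with the typing above and $t;u=v;s$. Identity cells: $\langle h,id,id,h\rangle$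 and $\langle id,v,v,id\rangle$. Horizontal composition of $A=\langle s_1,u_1,v_1,t_1\rangle$, $B=\langle s_2,u_2,v_2,t_2\rangle$ with $v_1=u_2$: $A*B=\langle s_2;s_1,u_1,v_2,t_2;t_1\rangle$; vertical composition when $t_1=s_2$: $A\cdot B=\langle s_1,u_2;u_1,v_2;v_1,t_2\rangle$; parallel composition $\otimes$ componentwise. The pullback basis $\mathcal{B}(\Sigma)$ consists of, for each $n$-ary $f\in\Sigma$: $R_f=\langle f,f,id_{\underline{n}},id_{\underline{n}}\rangle$, $D_f=\langle f\otimes id_{\underline{1}},\nabla_{\underline{1}},\nabla_{\underline{n}};(id_{\underline{n}}\otimes f),f\rangle$, $\hat D_f=\langle\nabla_{\underline{1}},f\otimes id_{\underline{1}},f,\nabla_{\underline{n}};(id_{\underline{n}}\otimes f)\rangle$; and $R_\nabla=\langle\nabla_{\underline{1}},\nabla_{\underline{1}},id_{\underline{1}},id_{\underline{1}}\rangle$, $R_\gamma=\langle\gamma_{\underline{1},\underline{1}},\gamma_{\underline{1},\underline{1}},id_{\underline{2}},id_{\underline{2}}\rangle$, $D_\nabla=\langle\nabla_{\underline{1}}\otimes id_{\underline{1}},id_{\underline{1}}\otimes\nabla_{\underline{1}},\nabla_{\underline{1}},\nabla_{\underline{1}}\rangle$. A cell is generated by $\mathcal{B}(\Sigma)$ if obtained from cells of $\mathcal{B}(\Sigma)$ and identity cells by finitely many horizontal, vertical and parallel compositions. *)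

theory Defs
  imports Main
begin

text \<open>
  A one-sorted signature is a family of sets of operation symbols indexed by arity;
  variables are numbered from \<open>0\<close>, so \<open>Var i\<close> stands for \<open>x\<close> with index \<open>i + 1\<close>.
\<close>

type_synonym 'f signature = "nat \<Rightarrow> 'f set"

datatype 'f trm = Var nat | App 'f "'f trm list"

fun is_trm :: "'f signature \<Rightarrow> nat \<Rightarrow> 'f trm \<Rightarrow> bool" where
  "is_trm \<Sigma> n (Var i) \<longleftrightarrow> i < n"
| "is_trm \<Sigma> n (App f ts) \<longleftrightarrow> f \<in> \<Sigma> (length ts) \<and> (\<forall>t\<in>set ts. is_trm \<Sigma> n t)"

fun subst :: "(nat \<Rightarrow> 'f trm) \<Rightarrow> 'f trm \<Rightarrow> 'f trm" where
  "subst \<sigma> (Var i) = \<sigma> i"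
| "subst \<sigma> (App f ts) = App f (map (subst \<sigma>) ts)"


subsection \<open>The free algebraic theory\<close>

text \<open>
  The source is stored explicitly because a tuple of terms does not determine
  the number of variables over which it is taken.
\<close>

datatype 'f arrow = Arrow (src: nat) (comps: "'f trm list")

definition hom :: "'f signature \<Rightarrow> nat \<Rightarrow> nat \<Rightarrow> 'f arrow set" where
  "hom \<Sigma> n m = {a. src a = n \<and> length (comps a) = m \<and> (\<forall>t\<in>set (comps a). is_trm \<Sigma> n t)}"

definition ident :: "nat \<Rightarrow> 'f arrow" where
  "ident n = Arrow n (map Var [0..<n])"

text \<open>Composition is in diagrammatic order: \<open>a ;; b\<close> is \<open>a\<close> followed by \<open>b\<close>.\<close>

definition seq :: "'f arrow \<Rightarrow> 'f arrow \<Rightarrow> 'f arrow" (infixl \<open>;;\<close> 60) where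
  "a ;; b = Arrow (src a) (map (subst (\<lambda>i. comps a ! i)) (comps b))"

definition tensor :: "'f arrow \<Rightarrow> 'f arrow \<Rightarrow> 'f arrow" (infixr \<open>\<otimes>\<close> 70) where
  "a \<otimes> b = Arrow (src a + src b) (comps a @ map (subst (\<lambda>i. Var (src a + i))) (comps b))"

definition opr :: "nat \<Rightarrow> 'f \<Rightarrow> 'f arrow" where
  "opr n f = Arrow n [App f (map Var [0..<n])]"

definition symm :: "nat \<Rightarrow> nat \<Rightarrow> 'f arrow" where
  "symm n m = Arrow (n + m) (map Var ([n..<n + m] @ [0..<n]))"

definition dupl :: "nat \<Rightarrow> 'f arrow" where
  "dupl n = Arrow n (map Var ([0..<n] @ [0..<n]))"

definition is_pullback ::
  "'f signature \<Rightarrow> 'f arrow \<Rightarrow> 'f arrow \<Rightarrow> nat \<Rightarrow> 'f arrow \<Rightarrow> 'f arrow \<Rightarrow> bool" where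
  "is_pullback \<Sigma> s u p v t \<longleftrightarrow>
     (\<exists>a b c. s \<in> hom \<Sigma> a c \<and> u \<in> hom \<Sigma> b c \<and> v \<in> hom \<Sigma> p a \<and> t \<in> hom \<Sigma> p b \<and>
        t ;; u = v ;; s \<and>
        (\<forall>q. \<forall>v'\<in>hom \<Sigma> q a. \<forall>t'\<in>hom \<Sigma> q b. t' ;; u = v' ;; s \<longrightarrow>
           (\<exists>!h. h \<in> hom \<Sigma> q p \<and> h ;; v = v' \<and> h ;; t = t')))"


subsection \<open>Cells\<close>

type_synonym 'f cell = "'f arrow \<times> 'f arrow \<times> 'f arrow \<times> 'f arrow"

definition cells :: "'f signature \<Rightarrow> 'f cell set" where
  "cells \<Sigma> = {(s, u, v, t). \<exists>o0 o1 o2 o3.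
     s \<in> hom \<Sigma> o1 o0 \<and> u \<in> hom \<Sigma> o2 o0 \<and> v \<in> hom \<Sigma> o3 o1 \<and> t \<in> hom \<Sigma> o3 o2 \<and>
     t ;; u = v ;; s}"

fun hcomp :: "'f cell \<Rightarrow> 'f cell \<Rightarrow> 'f cell" where
  "hcomp (s1, u1, v1, t1) (s2, u2, v2, t2) = (s2 ;; s1, u1, v2, t2 ;; t1)"

fun vcomp :: "'f cell \<Rightarrow> 'f cell \<Rightarrow> 'f cell" where
  "vcomp (s1, u1, v1, t1) (s2, u2, v2, t2) = (s1, u2 ;; u1, v2 ;; v1, t2)"

fun pcomp :: "'f cell \<Rightarrow> 'f cell \<Rightarrow> 'f cell" where
  "pcomp (s1, u1, v1, t1) (s2, u2, v2, t2) = (s1 \<otimes> s2, u1 \<otimes> u2, v1 \<otimes> v2, t1 \<otimes> t2)"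

inductive_set generated :: "'f signature \<Rightarrow> 'f cell set \<Rightarrow> 'f cell set"
  for \<Sigma> :: "'f signature" and B :: "'f cell set" where
  basic: "c \<in> B \<Longrightarrow> c \<in> generated \<Sigma> B"
| ident_h: "h \<in> hom \<Sigma> n m \<Longrightarrow> (h, ident m, ident n, h) \<in> generated \<Sigma> B"
| ident_v: "v \<in> hom \<Sigma> n m \<Longrightarrow> (ident m, v, v, ident n) \<in> generated \<Sigma> B"
| horizontal: "\<lbrakk>(s1, u1, v1, t1) \<in> generated \<Sigma> B; (s2, u2, v2, t2) \<in> generated \<Sigma> B; v1 = u2\<rbrakk>
    \<Longrightarrow> hcomp (s1, u1, v1, t1) (s2, u2, v2, t2) \<in> generated \<Sigma> B"
| vertical: "\<lbrakk>(s1, u1, v1, t1) \<in> generated \<Sigma> B; (s2, u2, v2, t2) \<in> generated \<Sigma> B; t1 = s2\<rbrakk>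
    \<Longrightarrow> vcomp (s1, u1, v1, t1) (s2, u2, v2, t2) \<in> generated \<Sigma> B"
| parallel: "\<lbrakk>c \<in> generated \<Sigma> B; d \<in> generated \<Sigma> B\<rbrakk> \<Longrightarrow> pcomp c d \<in> generated \<Sigma> B"


subsection \<open>The pullback basis\<close>

definition R_op :: "nat \<Rightarrow> 'f \<Rightarrow> 'f cell" where
  "R_op n f = (opr n f, opr n f, ident n, ident n)"

definition D_op :: "nat \<Rightarrow> 'f \<Rightarrow> 'f cell" where
  "D_op n f = (opr n f \<otimes> ident 1, dupl 1, dupl n ;; (ident n \<otimes> opr n f), opr n f)"

definition D_hat_op :: "nat \<Rightarrow> 'f \<Rightarrow> 'f cell" where
  "D_hat_op n f = (dupl 1, opr n f \<otimes> ident 1, opr n f, dupl n ;; (ident n \<otimes> opr n f))"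

definition R_dupl :: "'f cell" where
  "R_dupl = (dupl 1, dupl 1, ident 1, ident 1)"

definition R_symm :: "'f cell" where
  "R_symm = (symm 1 1, symm 1 1, ident 2, ident 2)"

definition D_dupl :: "'f cell" where
  "D_dupl = (dupl 1 \<otimes> ident 1, ident 1 \<otimes> dupl 1, dupl 1, dupl 1)"

definition pullback_basis :: "'f signature \<Rightarrow> 'f cell set" where
  "pullback_basis \<Sigma> =
     (\<Union>n. \<Union>f\<in>\<Sigma> n. {R_op n f, D_op n f, D_hat_op n f}) \<union> {R_dupl, R_symm, D_dupl}"


subsection \<open>Well-typedness of generated cells\<close>

lemma subst_subst: "subst \<sigma> (subst \<tau> t) = subst (\<lambda>i. subst \<sigma> (\<tau> i)) t"
  by (induction t) auto

lemma subst_cong: "is_trm \<Sigma> n t \<Longrightarrow> (\<And>i. i < n \<Longrightarrow> \<sigma> i = \<tau> i) \<Longrightarrow> subst \<sigma> t = subst \<tau> t"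
  by (induction t) auto

lemma subst_Var: "subst Var t = t"
  by (induction t) (auto simp: map_idI)

lemma is_trm_subst:
  "is_trm \<Sigma> n t \<Longrightarrow> (\<And>i. i < n \<Longrightarrow> is_trm \<Sigma> m (\<sigma> i)) \<Longrightarrow> is_trm \<Sigma> m (subst \<sigma> t)"
  by (induction t) auto

lemma is_trm_mono: "is_trm \<Sigma> n t \<Longrightarrow> n \<le> m \<Longrightarrow> is_trm \<Sigma> m t"
  by (induction t) auto

lemma ident_hom: "ident n \<in> hom \<Sigma> n n"
  by (auto simp: hom_def ident_def)

lemma opr_hom: "f \<in> \<Sigma> n \<Longrightarrow> opr n f \<in> hom \<Sigma> n 1"
  by (auto simp: hom_def opr_def)

lemma symm_hom: "symm n m \<in> hom \<Sigma> (n + m) (m + n)"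
  by (auto simp: hom_def symm_def)

lemma dupl_hom: "dupl n \<in> hom \<Sigma> n (n + n)"
  by (auto simp: hom_def dupl_def)

lemma seq_hom: "a \<in> hom \<Sigma> n k \<Longrightarrow> b \<in> hom \<Sigma> k m \<Longrightarrow> a ;; b \<in> hom \<Sigma> n m"
  by (auto simp: hom_def seq_def intro!: is_trm_subst)

lemma tensor_hom:
  "a \<in> hom \<Sigma> n m \<Longrightarrow> b \<in> hom \<Sigma> n' m' \<Longrightarrow> a \<otimes> b \<in> hom \<Sigma> (n + n') (m + m')"
  by (auto simp: hom_def tensor_def intro: is_trm_mono intro!: is_trm_subst)

lemma seq_assoc:
  assumes "a \<in> hom \<Sigma> n k" "b \<in> hom \<Sigma> k l" "c \<in> hom \<Sigma> l m"
  shows "(a ;; b) ;; c = a ;; (b ;; c)"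
  using assms by (auto simp: hom_def seq_def subst_subst intro!: subst_cong)

lemma ident_seq: "a \<in> hom \<Sigma> n m \<Longrightarrow> ident n ;; a = a"
  by (cases a)
    (auto simp: hom_def seq_def ident_def subst_Var intro!: map_idI
      intro: trans[OF subst_cong[where \<tau> = Var] subst_Var])

lemma seq_ident: "a \<in> hom \<Sigma> n m \<Longrightarrow> a ;; ident m = a"
  by (cases a) (auto simp: hom_def seq_def ident_def intro!: nth_equalityI)

lemma tensor_seq:
  assumes "a \<in> hom \<Sigma> n k" "b \<in> hom \<Sigma> k m" "a' \<in> hom \<Sigma> n' k'" "b' \<in> hom \<Sigma> k' m'"
  shows "(a \<otimes> a') ;; (b \<otimes> b') = (a ;; b) \<otimes> (a' ;; b')"
  using assms
  by (auto simp: hom_def seq_def tensor_def subst_subst nth_append intro!: subst_cong)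

lemma pullback_basis_cells: "pullback_basis \<Sigma> \<subseteq> cells \<Sigma>"
proof -
  have "R_op n f \<in> cells \<Sigma>" if "f \<in> \<Sigma> n" for n f
    unfolding R_op_def cells_def using opr_hom[of f \<Sigma> n, OF that] ident_hom[of n \<Sigma>] by blast
  moreover have "D_op n f \<in> cells \<Sigma>" "D_hat_op n f \<in> cells \<Sigma>" if f: "f \<in> \<Sigma> n" for n f
  proof -
    let ?d = "dupl n ;; (ident n \<otimes> opr n f)"
    have 1: "opr n f \<otimes> ident 1 \<in> hom \<Sigma> (n + 1) (1 + 1)" "?d \<in> hom \<Sigma> n (n + 1)"
      "dupl 1 \<in> hom \<Sigma> 1 (1 + 1)" "opr n f \<in> hom \<Sigma> n 1"
      by (rule tensor_hom[OF opr_hom ident_hom] seq_hom[OF dupl_hom tensor_hom[OF ident_hom opr_hom]]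
            dupl_hom opr_hom, (rule f)?)+
    have 2: "opr n f ;; dupl 1 = ?d ;; (opr n f \<otimes> ident 1)"
      by (auto simp: seq_def opr_def dupl_def tensor_def ident_def nth_append intro!: nth_equalityI)
    show "D_op n f \<in> cells \<Sigma>" "D_hat_op n f \<in> cells \<Sigma>"
      unfolding D_op_def D_hat_op_def cells_def using 1 2 2[symmetric] by blast+
  qed
  moreover have "R_dupl \<in> cells \<Sigma>"
    unfolding R_dupl_def cells_def using dupl_hom[of 1 \<Sigma>] ident_hom[of 1 \<Sigma>] by blast
  moreover have "R_symm \<in> cells \<Sigma>"
    unfolding R_symm_def cells_def
    using symm_hom[of 1 1 \<Sigma>, unfolded one_add_one] ident_hom[of 2 \<Sigma>] by blast
  moreover have "D_dupl \<in> cells \<Sigma>"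
    unfolding D_dupl_def cells_def
    by (auto simp: hom_def dupl_def tensor_def ident_def seq_def)
  ultimately show ?thesis
    by (auto simp: pullback_basis_def)
qed

lemma hom_unique: "a \<in> hom \<Sigma> n m \<Longrightarrow> a \<in> hom \<Sigma> n' m' \<Longrightarrow> n = n' \<and> m = m'"
  by (auto simp: hom_def)

lemma generated_cells:
  assumes "B \<subseteq> cells \<Sigma>"
  shows "generated \<Sigma> B \<subseteq> cells \<Sigma>"
proof
  fix c assume "c \<in> generated \<Sigma> B"
  then show "c \<in> cells \<Sigma>"
  proof induction
    case (basic c)
    then show ?case using assms by auto
  next
    case (ident_h h n m)
    then show ?case
      by (auto simp: cells_def seq_ident ident_seq intro!: exI ident_hom)
  next
    case (ident_v v n m)
    then show ?case
      by (auto simp: cells_def seq_ident ident_seq intro!: exI ident_hom)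
  next
    case (horizontal s1 u1 v1 t1 s2 u2 v2 t2)
    from horizontal.IH(1) obtain a b c d where 1: "s1 \<in> hom \<Sigma> b a" "u1 \<in> hom \<Sigma> c a"
      "v1 \<in> hom \<Sigma> d b" "t1 \<in> hom \<Sigma> d c" "t1 ;; u1 = v1 ;; s1"
      by (auto simp: cells_def)
    with horizontal.IH(2) \<open>v1 = u2\<close> obtain b' d' where 2: "s2 \<in> hom \<Sigma> b' b"
      "v2 \<in> hom \<Sigma> d' b'" "t2 \<in> hom \<Sigma> d' d" "t2 ;; v1 = v2 ;; s2"
      by (auto simp: cells_def dest: hom_unique)
    have "(t2 ;; t1) ;; u1 = v2 ;; (s2 ;; s1)"
      using 1 2 by (metis seq_assoc)
    then show ?case
      using 1 2 by (auto simp: cells_def intro!: exI seq_hom)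
  next
    case (vertical s1 u1 v1 t1 s2 u2 v2 t2)
    from vertical.IH(1) obtain a b c d where 1: "s1 \<in> hom \<Sigma> b a" "u1 \<in> hom \<Sigma> c a"
      "v1 \<in> hom \<Sigma> d b" "t1 \<in> hom \<Sigma> d c" "t1 ;; u1 = v1 ;; s1"
      by (auto simp: cells_def)
    with vertical.IH(2) \<open>t1 = s2\<close> obtain c' d' where 2: "u2 \<in> hom \<Sigma> c' c"
      "v2 \<in> hom \<Sigma> d' d" "t2 \<in> hom \<Sigma> d' c'" "t2 ;; u2 = v2 ;; t1"
      by (auto simp: cells_def dest: hom_unique)
    have "t2 ;; (u2 ;; u1) = (v2 ;; v1) ;; s1"
      using 1 2 by (metis seq_assoc)
    then show ?case
      using 1 2 by (auto simp: cells_def intro!: exI seq_hom)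
  next
    case (parallel c d)
    from parallel.IH(1) obtain s u v t o0 o1 o2 o3 where 1: "c = (s, u, v, t)"
      "s \<in> hom \<Sigma> o1 o0" "u \<in> hom \<Sigma> o2 o0" "v \<in> hom \<Sigma> o3 o1" "t \<in> hom \<Sigma> o3 o2" "t ;; u = v ;; s"
      by (auto simp: cells_def)
    from parallel.IH(2) obtain s' u' v' t' p0 p1 p2 p3 where 2: "d = (s', u', v', t')"
      "s' \<in> hom \<Sigma> p1 p0" "u' \<in> hom \<Sigma> p2 p0" "v' \<in> hom \<Sigma> p3 p1" "t' \<in> hom \<Sigma> p3 p2"
      "t' ;; u' = v' ;; s'"
      by (auto simp: cells_def)
    have "(t \<otimes> t') ;; (u \<otimes> u') = (v \<otimes> v') ;; (s \<otimes> s')"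
      using 1 2 by (simp add: tensor_seq)
    moreover have "s \<otimes> s' \<in> hom \<Sigma> (o1 + p1) (o0 + p0)" "u \<otimes> u' \<in> hom \<Sigma> (o2 + p2) (o0 + p0)"
      "v \<otimes> v' \<in> hom \<Sigma> (o3 + p3) (o1 + p1)" "t \<otimes> t' \<in> hom \<Sigma> (o3 + p3) (o2 + p2)"
      using 1 2 by (auto intro: tensor_hom)
    ultimately show ?case
      unfolding 1(1) 2(1) pcomp.simps cells_def by blast
  qed
qed

end

(* Pullbacks in the free theory are most general unifiers. That generated cells are pullbacks is
   pasting together with the stability of pullbacks under products. Conversely, pullbacks are unique up
   to isomorphism and isomorphisms are permutations, so it is enough to complete every cospan s, u that
   has a cone to some generated cell. Unused variables are split off by a discharger, which leaves
   arrows s, u that use all their variables. Such an arrow is a permutation or ends, up to a permutation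
   of its target, in an operation or a duplicator; these final factors of s and u meet in a basic cell or
   in a tensor of identity cells. The rest is filled by a two-by-two grid, by induction on the size of
   the common value x;s = y;u of a cone (x, y): cutting off an operation or a duplicator strictly
   decreases that size, so no separate termination argument for unification is needed. *)

theory Submission
  imports Defs "HOL-Library.Multiset"
begin

subsection \<open>Pairing\<close>

text \<open>A recursive completion of cospans could meet a subproblem without solution or fail to
  end. One fixed cone \<open>(x, y)\<close> with source \<open>q\<close> guards against both. Every
  cell already placed is a pullback, so the cone factors through it, and the factors form cones with
  the same source \<open>q\<close> over the next cospans, with values of smaller size. Relevance is
  what yields the inequality: if \<open>b\<close> uses all its variables, every component of
  \<open>a\<close> occurs inside \<open>a ;; b\<close>, whereas a discharger can erase arbitrarily
  large terms. Pullback legs of relevant arrows are again relevant, so this invariant survives. A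
  clash of symbols contradicts the cone, and a failing occurs check never has to be recognised.
  Permutations need separate work because the basis contains the swap only in \<open>R_symm\<close>,
  with identities at the apex; a cell with swaps at the apex has to be composed first.\<close>

definition pairing :: "'f arrow \<Rightarrow> 'f arrow \<Rightarrow> 'f arrow" where
  "pairing x y = Arrow (src x) (comps x @ comps y)"

lemma pairing_hom: "x \<in> hom \<Sigma> q m \<Longrightarrow> y \<in> hom \<Sigma> q n \<Longrightarrow> pairing x y \<in> hom \<Sigma> q (m + n)"
  by (auto simp: hom_def pairing_def)

lemma pairing_inject:
  assumes "x \<in> hom \<Sigma> q m" "x' \<in> hom \<Sigma> q m" "y \<in> hom \<Sigma> q n" "y' \<in> hom \<Sigma> q n"
  shows "pairing x y = pairing x' y' \<longleftrightarrow> x = x' \<and> y = y'"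
  using assms by (cases x; cases x'; cases y; cases y') (auto simp: hom_def pairing_def)

text \<open>This makes \<open>m + n\<close> the categorical product of \<open>m\<close> and
  \<open>n\<close>, so universal properties of tensors can be checked componentwise.\<close>

lemma pairing_cases:
  assumes "z \<in> hom \<Sigma> q (m + n)"
  obtains x y where "x \<in> hom \<Sigma> q m" "y \<in> hom \<Sigma> q n" "z = pairing x y"
proof
  show "Arrow q (take m (comps z)) \<in> hom \<Sigma> q m" "Arrow q (drop m (comps z)) \<in> hom \<Sigma> q n"
    using assms by (auto simp: hom_def dest: in_set_takeD in_set_dropD)
  show "z = pairing (Arrow q (take m (comps z))) (Arrow q (drop m (comps z)))"
    using assms by (cases z) (auto simp: hom_def pairing_def)
qed

lemma pairing_assoc: "pairing (pairing x y) z = pairing x (pairing y z)"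
  by (simp add: pairing_def)

lemma pairing_tensor:
  assumes "x \<in> hom \<Sigma> q n" "y \<in> hom \<Sigma> q n'" "a \<in> hom \<Sigma> n m" "b \<in> hom \<Sigma> n' m'"
  shows "pairing x y ;; (a \<otimes> b) = pairing (x ;; a) (y ;; b)"
  using assms
  by (auto simp: hom_def seq_def tensor_def pairing_def subst_subst nth_append intro!: subst_cong)

lemma seq_dupl: "x \<in> hom \<Sigma> q n \<Longrightarrow> x ;; dupl n = pairing x x"
  by (cases x) (auto simp: hom_def seq_def dupl_def pairing_def nth_append intro!: nth_equalityI)

text \<open>With \<open>a\<close> an identity this computes the graph of \<open>b\<close>, the leg
  that occurs in \<open>D_op\<close> and \<open>D_hat_op\<close>.\<close>

lemma seq_dupl_tensor:
  assumes "x \<in> hom \<Sigma> q n" "a \<in> hom \<Sigma> n m" "b \<in> hom \<Sigma> n m'"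
  shows "x ;; (dupl n ;; (a \<otimes> b)) = pairing (x ;; a) (x ;; b)"
  using seq_assoc[OF assms(1) dupl_hom tensor_hom[OF assms(2,3)]]
    pairing_tensor[OF assms(1) assms(1) assms(2,3)] seq_dupl[OF assms(1)]
  by simp

lemma ident_tensor_ident: "ident m \<otimes> ident n = ident (m + n)"
  by (auto simp: tensor_def ident_def intro!: nth_equalityI simp: nth_append)

lemma ident_0_tensor: "ident 0 \<otimes> a = a"
  by (cases a) (auto simp: tensor_def ident_def subst_Var intro!: map_idI)

lemma tensor_ident_0: "a \<otimes> ident 0 = a"
  by (cases a) (auto simp: tensor_def ident_def)


subsection \<open>Pasting and products of pullback squares\<close>

text \<open>Variant of \<open>is_pullback\<close> with all four objects as parameters: pasting has
  to match the objects of adjacent squares, which an existential would hide.\<close>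

definition is_pb ::
  "'f signature \<Rightarrow> nat \<Rightarrow> nat \<Rightarrow> nat \<Rightarrow> nat \<Rightarrow> 'f arrow \<Rightarrow> 'f arrow \<Rightarrow> 'f arrow \<Rightarrow> 'f arrow \<Rightarrow> bool" where
  "is_pb \<Sigma> a b c p s u v t \<longleftrightarrow>
     s \<in> hom \<Sigma> a c \<and> u \<in> hom \<Sigma> b c \<and> v \<in> hom \<Sigma> p a \<and> t \<in> hom \<Sigma> p b \<and> t ;; u = v ;; s \<and>
     (\<forall>q. \<forall>v'\<in>hom \<Sigma> q a. \<forall>t'\<in>hom \<Sigma> q b. t' ;; u = v' ;; s \<longrightarrow>
        (\<exists>!h. h \<in> hom \<Sigma> q p \<and> h ;; v = v' \<and> h ;; t = t'))"

lemma is_pullback_iff: "is_pullback \<Sigma> s u p v t \<longleftrightarrow> (\<exists>a b c. is_pb \<Sigma> a b c p s u v t)"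
  by (simp add: is_pullback_def is_pb_def)

lemma is_pbI:
  assumes "s \<in> hom \<Sigma> a c" "u \<in> hom \<Sigma> b c" "v \<in> hom \<Sigma> p a" "t \<in> hom \<Sigma> p b" "t ;; u = v ;; s"
    and "\<And>q x y. \<lbrakk>x \<in> hom \<Sigma> q a; y \<in> hom \<Sigma> q b; y ;; u = x ;; s\<rbrakk>
      \<Longrightarrow> \<exists>h\<in>hom \<Sigma> q p. h ;; v = x \<and> h ;; t = y"
    and "\<And>q h k. \<lbrakk>h \<in> hom \<Sigma> q p; k \<in> hom \<Sigma> q p; h ;; v = k ;; v; h ;; t = k ;; t\<rbrakk> \<Longrightarrow> h = k"
  shows "is_pb \<Sigma> a b c p s u v t"
  unfolding is_pb_def
proof (intro conjI allI ballI impI)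
  fix q x y assume "x \<in> hom \<Sigma> q a" "y \<in> hom \<Sigma> q b" "y ;; u = x ;; s"
  then obtain h where "h\<in>hom \<Sigma> q p" "h ;; v = x" "h ;; t = y"
    using assms(6) by blast
  then show "\<exists>!h. h \<in> hom \<Sigma> q p \<and> h ;; v = x \<and> h ;; t = y"
    using assms(7) by metis
qed (use assms in auto)

lemma is_pb_factor:
  assumes "is_pb \<Sigma> a b c p s u v t" "x \<in> hom \<Sigma> q a" "y \<in> hom \<Sigma> q b" "y ;; u = x ;; s"
  obtains h where "h \<in> hom \<Sigma> q p" "h ;; v = x" "h ;; t = y"
  using assms unfolding is_pb_def by blast

text \<open>Joint monicity of the legs: \<open>h\<close> and \<open>k\<close> both mediate for the
  cone \<open>(k ;; v, k ;; t)\<close>.\<close>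

lemma is_pb_unique:
  assumes pb: "is_pb \<Sigma> a b c p s u v t" and h: "h \<in> hom \<Sigma> q p" and k: "k \<in> hom \<Sigma> q p"
    and eq: "h ;; v = k ;; v" "h ;; t = k ;; t"
  shows "h = k"
proof -
  have s: "s \<in> hom \<Sigma> a c" "u \<in> hom \<Sigma> b c" "v \<in> hom \<Sigma> p a" "t \<in> hom \<Sigma> p b" "t ;; u = v ;; s"
    using pb by (auto simp: is_pb_def)
  have "k ;; v \<in> hom \<Sigma> q a" "k ;; t \<in> hom \<Sigma> q b" "(k ;; t) ;; u = (k ;; v) ;; s"
    using s k by (auto simp: seq_hom seq_assoc)
  then show ?thesis
    using pb h k eq unfolding is_pb_def by blast
qed

lemma is_pb_homD:
  assumes "is_pb \<Sigma> a b c p s u v t"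
  shows "s \<in> hom \<Sigma> a c" "u \<in> hom \<Sigma> b c" "v \<in> hom \<Sigma> p a" "t \<in> hom \<Sigma> p b" "t ;; u = v ;; s"
  using assms by (auto simp: is_pb_def)

lemma is_pb_sym: "is_pb \<Sigma> a b c p s u v t \<Longrightarrow> is_pb \<Sigma> b a c p u s t v"
  by (rule is_pbI) (auto dest: is_pb_homD elim: is_pb_factor intro: is_pb_unique)

lemma is_pb_ident:
  assumes "h \<in> hom \<Sigma> n m"
  shows "is_pb \<Sigma> n m m n h (ident m) (ident n) h"
  using assms by (intro is_pbI) (auto simp: ident_hom seq_ident ident_seq)

text \<open>The kernel pair of a monomorphism is trivial. This accounts for \<open>R_op\<close>,
  \<open>R_dupl\<close> and \<open>R_symm\<close>.\<close>

lemma is_pb_mono: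
  assumes "m \<in> hom \<Sigma> n k"
    and "\<And>q x y. \<lbrakk>x \<in> hom \<Sigma> q n; y \<in> hom \<Sigma> q n; x ;; m = y ;; m\<rbrakk> \<Longrightarrow> x = y"
  shows "is_pb \<Sigma> n n k n m m (ident n) (ident n)"
  using assms(1)
proof (intro is_pbI)
  fix q x y assume "x \<in> hom \<Sigma> q n" "y \<in> hom \<Sigma> q n" "y ;; m = x ;; m"
  then show "\<exists>h\<in>hom \<Sigma> q n. h ;; ident n = x \<and> h ;; ident n = y"
    using assms(2) seq_ident by blast
qed (auto simp: ident_hom seq_ident)

text \<open>Pasting: an outer cone is factored through the first square, and the mediating arrow
  together with \<open>x\<close> is then a cone over the second.\<close>

lemma is_pb_hcomp:
  assumes 1: "is_pb \<Sigma> a b c d s1 u1 v1 t1" and 2: "is_pb \<Sigma> a' d a d' s2 v1 v2 t2"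
  shows "is_pb \<Sigma> a' b c d' (s2 ;; s1) u1 v2 (t2 ;; t1)"
proof -
  note h = is_pb_homD[OF 1] is_pb_homD[OF 2]
  show ?thesis
  proof (rule is_pbI)
    show "(t2 ;; t1) ;; u1 = v2 ;; (s2 ;; s1)"
      using h by (metis seq_assoc)
  next
    fix q x y assume x: "x \<in> hom \<Sigma> q a'" "y \<in> hom \<Sigma> q b" "y ;; u1 = x ;; (s2 ;; s1)"
    then have "y ;; u1 = (x ;; s2) ;; s1"
      using h by (metis seq_assoc)
    then obtain k where k: "k \<in> hom \<Sigma> q d" "k ;; v1 = x ;; s2" "k ;; t1 = y"
      using is_pb_factor[OF 1 seq_hom[OF x(1) h(6)] x(2)] by blast
    then obtain l where l: "l \<in> hom \<Sigma> q d'" "l ;; v2 = x" "l ;; t2 = k"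
      using is_pb_factor[OF 2 x(1) k(1)] by blast
    then show "\<exists>l\<in>hom \<Sigma> q d'. l ;; v2 = x \<and> l ;; (t2 ;; t1) = y"
      using h k by (metis seq_assoc)
  next
    fix q k l assume k: "k \<in> hom \<Sigma> q d'" "l \<in> hom \<Sigma> q d'" "k ;; v2 = l ;; v2"
      "k ;; (t2 ;; t1) = l ;; (t2 ;; t1)"
    have "(k ;; t2) ;; v1 = (l ;; t2) ;; v1" "(k ;; t2) ;; t1 = (l ;; t2) ;; t1"
      using k(3,4) seq_assoc[OF k(1) h(9) h(3)] seq_assoc[OF k(2) h(9) h(3)]
        seq_assoc[OF k(1) h(8) h(6)] seq_assoc[OF k(2) h(8) h(6)]
        seq_assoc[OF k(1) h(9) h(4)] seq_assoc[OF k(2) h(9) h(4)] h(10)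
      by simp_all
    then have "k ;; t2 = l ;; t2"
      using is_pb_unique[OF 1] seq_hom h k by blast
    then show "k = l"
      using is_pb_unique[OF 2] k by blast
  qed (use h in \<open>auto intro: seq_hom\<close>)
qed

lemma is_pb_vcomp:
  assumes "is_pb \<Sigma> a b c d s1 u1 v1 t1" and "is_pb \<Sigma> d b' b d' t1 u2 v2 t2"
  shows "is_pb \<Sigma> a b' c d' s1 (u2 ;; u1) (v2 ;; v1) t2"
  using assms by (blast intro: is_pb_sym is_pb_hcomp)

text \<open>Since tensors are products, both the cones and the mediating arrows split into
  pairs.\<close>

lemma is_pb_tensor:
  assumes 1: "is_pb \<Sigma> a b c d s u v t" and 2: "is_pb \<Sigma> a' b' c' d' s' u' v' t'"
  shows "is_pb \<Sigma> (a + a') (b + b') (c + c') (d + d') (s \<otimes> s') (u \<otimes> u') (v \<otimes> v') (t \<otimes> t')"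
proof -
  note h = is_pb_homD[OF 1] is_pb_homD[OF 2]
  show ?thesis
  proof (rule is_pbI)
    show "(t \<otimes> t') ;; (u \<otimes> u') = (v \<otimes> v') ;; (s \<otimes> s')"
      using h by (simp add: tensor_seq)
  next
    fix q x y assume "x \<in> hom \<Sigma> q (a + a')" "y \<in> hom \<Sigma> q (b + b')"
      and eq: "y ;; (u \<otimes> u') = x ;; (s \<otimes> s')"
    then obtain x1 x2 y1 y2 where x: "x1 \<in> hom \<Sigma> q a" "x2 \<in> hom \<Sigma> q a'" "x = pairing x1 x2"
      and y: "y1 \<in> hom \<Sigma> q b" "y2 \<in> hom \<Sigma> q b'" "y = pairing y1 y2"
      by (metis pairing_cases)
    have "pairing (y1 ;; u) (y2 ;; u') = pairing (x1 ;; s) (x2 ;; s')"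
      using eq x y h by (simp add: pairing_tensor)
    then have "y1 ;; u = x1 ;; s" "y2 ;; u' = x2 ;; s'"
      by (simp_all add: pairing_inject[OF seq_hom[OF y(1) h(2)] seq_hom[OF x(1) h(1)]
            seq_hom[OF y(2) h(7)] seq_hom[OF x(2) h(6)]])
    then obtain k k' where "k \<in> hom \<Sigma> q d" "k ;; v = x1" "k ;; t = y1"
      "k' \<in> hom \<Sigma> q d'" "k' ;; v' = x2" "k' ;; t' = y2"
      using is_pb_factor[OF 1 x(1) y(1)] is_pb_factor[OF 2 x(2) y(2)] by metis
    then show "\<exists>k\<in>hom \<Sigma> q (d + d'). k ;; (v \<otimes> v') = x \<and> k ;; (t \<otimes> t') = y"
      using h x y by (intro bexI[of _ "pairing k k'"]) (auto simp: pairing_tensor pairing_hom)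
  next
    fix q k l assume "k \<in> hom \<Sigma> q (d + d')" "l \<in> hom \<Sigma> q (d + d')"
      and eq: "k ;; (v \<otimes> v') = l ;; (v \<otimes> v')" "k ;; (t \<otimes> t') = l ;; (t \<otimes> t')"
    then obtain k1 k2 l1 l2 where k: "k1 \<in> hom \<Sigma> q d" "k2 \<in> hom \<Sigma> q d'" "k = pairing k1 k2"
      and l: "l1 \<in> hom \<Sigma> q d" "l2 \<in> hom \<Sigma> q d'" "l = pairing l1 l2"
      by (metis pairing_cases)
    have "pairing (k1 ;; v) (k2 ;; v') = pairing (l1 ;; v) (l2 ;; v')"
      "pairing (k1 ;; t) (k2 ;; t') = pairing (l1 ;; t) (l2 ;; t')"
      using eq k l h by (simp_all add: pairing_tensor)
    then have "k1 ;; v = l1 ;; v" "k2 ;; v' = l2 ;; v'" "k1 ;; t = l1 ;; t" "k2 ;; t' = l2 ;; t'"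
      by (simp_all add: pairing_inject[OF seq_hom[OF k(1) h(3)] seq_hom[OF l(1) h(3)]
            seq_hom[OF k(2) h(8)] seq_hom[OF l(2) h(8)]]
          pairing_inject[OF seq_hom[OF k(1) h(4)] seq_hom[OF l(1) h(4)]
            seq_hom[OF k(2) h(9)] seq_hom[OF l(2) h(9)]])
    then show "k = l"
      using is_pb_unique[OF 1 k(1) l(1)] is_pb_unique[OF 2 k(2) l(2)] k l by simp
  qed (use h in \<open>auto intro: tensor_hom\<close>)
qed


subsection \<open>Generated cells are pullbacks\<close>

text \<open>Operations are monic because terms are free: \<open>App f ts\<close> determines
  \<open>ts\<close>.\<close>

lemma opr_inject:
  assumes "x \<in> hom \<Sigma> q n" "y \<in> hom \<Sigma> q n" "x ;; opr n f = y ;; opr n f"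
  shows "x = y"
proof -
  have "map (\<lambda>i. comps x ! i) [0..<n] = map (\<lambda>i. comps y ! i) [0..<n]"
    using assms(3) by (simp add: seq_def opr_def comp_def)
  then show ?thesis
    using assms(1,2) by (cases x; cases y) (auto simp: hom_def intro!: nth_equalityI)
qed

text \<open>In a cone, \<open>x\<close> is a pair \<open>(z, w)\<close> and the equation reads
  \<open>(y, y) = (z ;; opr n f, w)\<close>; so \<open>z\<close> determines the whole cone and is
  itself the mediating arrow.\<close>

lemma is_pb_D_op:
  assumes f: "f \<in> \<Sigma> n"
  shows "is_pb \<Sigma> (n + 1) 1 (1 + 1) n (opr n f \<otimes> ident 1) (dupl 1) (dupl n ;; (ident n \<otimes> opr n f)) (opr n f)"
proof -
  note F = opr_hom[of f \<Sigma> n, OF f] and i = ident_hom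
  have graph: "x ;; (dupl n ;; (ident n \<otimes> opr n f)) = pairing x (x ;; opr n f)"
    if "x \<in> hom \<Sigma> q n" for x q
    using seq_dupl_tensor[OF that i F] seq_ident[OF that] by simp
  show ?thesis
  proof (rule is_pbI)
    show "opr n f ;; dupl 1 = (dupl n ;; (ident n \<otimes> opr n f)) ;; (opr n f \<otimes> ident 1)"
      by (auto simp: seq_def opr_def dupl_def tensor_def ident_def nth_append intro!: nth_equalityI)
  next
    fix q x y assume "x \<in> hom \<Sigma> q (n + 1)" and y: "y \<in> hom \<Sigma> q 1"
      and eq: "y ;; dupl 1 = x ;; (opr n f \<otimes> ident 1)"
    then obtain z w where x: "z \<in> hom \<Sigma> q n" "w \<in> hom \<Sigma> q 1" "x = pairing z w"
      by (metis pairing_cases)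
    then have "pairing y y = pairing (z ;; opr n f) w"
      using eq seq_dupl[OF y] pairing_tensor[OF x(1,2) F i] seq_ident[OF x(2)] by simp
    then have "y = z ;; opr n f" "y = w"
      using pairing_inject[OF y seq_hom[OF x(1) F] y x(2)] by auto
    then show "\<exists>h\<in>hom \<Sigma> q n. h ;; (dupl n ;; (ident n \<otimes> opr n f)) = x \<and> h ;; opr n f = y"
      using graph x by blast
  next
    fix q h k assume "h \<in> hom \<Sigma> q n" "k \<in> hom \<Sigma> q n" "h ;; opr n f = k ;; opr n f"
    then show "h = k" by (rule opr_inject)
  qed (rule tensor_hom[OF F i] dupl_hom seq_hom[OF dupl_hom tensor_hom[OF i F]] F)+
qed

lemma is_pb_D_dupl: "is_pb \<Sigma> 2 2 3 1 (dupl 1 \<otimes> ident 1) (ident 1 \<otimes> dupl 1) (dupl 1) (dupl 1)"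
proof (rule is_pbI)
  note d = dupl_hom[of 1 \<Sigma>] and i = ident_hom[of 1 \<Sigma>]
  show "dupl 1 \<otimes> ident 1 \<in> hom \<Sigma> 2 3" "ident 1 \<otimes> dupl 1 \<in> hom \<Sigma> 2 3" "dupl 1 \<in> hom \<Sigma> 1 2"
    "dupl 1 \<in> hom \<Sigma> 1 2"
    using tensor_hom[OF d i] tensor_hom[OF i d] d by (simp_all add: numeral_2_eq_2 numeral_3_eq_3)
  show "dupl 1 ;; (ident 1 \<otimes> dupl 1) = dupl 1 ;; (dupl 1 \<otimes> ident 1)"
    by (simp add: seq_def dupl_def tensor_def ident_def)
next
  note d = dupl_hom[of 1 \<Sigma>] and i = ident_hom[of 1 \<Sigma>]
  fix q x y assume "x \<in> hom \<Sigma> q 2" "y \<in> hom \<Sigma> q 2"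
    and eq: "y ;; (ident 1 \<otimes> dupl 1) = x ;; (dupl 1 \<otimes> ident 1)"
  then obtain a b c e where x: "a \<in> hom \<Sigma> q 1" "b \<in> hom \<Sigma> q 1" "x = pairing a b"
    and y: "c \<in> hom \<Sigma> q 1" "e \<in> hom \<Sigma> q 1" "y = pairing c e"
    by (metis pairing_cases one_add_one)
  \<comment> \<open>Read as \<open>(c, e, e) = (a, a, b)\<close>: all four components coincide, and
    their common value mediates.\<close>
  have "pairing c (pairing e e) = pairing (pairing a a) b"
    using eq x y pairing_tensor[OF x(1,2) d i] pairing_tensor[OF y(1,2) i d]
    by (simp add: seq_dupl seq_ident)
  then have "c = a" "e = a" "e = b"
    using x y pairing_inject[of c \<Sigma> q 1 a "pairing e e" "1 + 1" "pairing a b"]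
      pairing_inject[of e \<Sigma> q 1 a e 1 b]
      pairing_hom[of e \<Sigma> q 1 e 1] pairing_hom[of a \<Sigma> q 1 b 1]
    by (auto simp: pairing_assoc)
  then show "\<exists>h\<in>hom \<Sigma> q 1. h ;; dupl 1 = x \<and> h ;; dupl 1 = y"
    using x y by (auto simp: seq_dupl)
next
  fix q h k assume "h \<in> hom \<Sigma> q 1" "k \<in> hom \<Sigma> q 1" "h ;; dupl 1 = k ;; dupl 1"
  then show "h = k" by (metis seq_dupl pairing_inject)
qed

lemma symm_1_1_seq: "symm 1 1 ;; symm 1 1 = ident 2"
  by (simp add: seq_def symm_def ident_def numeral_2_eq_2)

lemma symm_1_1_hom: "symm 1 1 \<in> hom \<Sigma> 2 2"
  using symm_hom[of 1 1 \<Sigma>] by (simp only: one_add_one)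

abbreviation gen :: "'f signature \<Rightarrow> 'f cell set" where
  "gen \<Sigma> \<equiv> generated \<Sigma> (pullback_basis \<Sigma>)"

lemma pullback_basis_is_pb:
  fixes \<Sigma> :: "'a signature"
  assumes "(s, u, v, t) \<in> pullback_basis \<Sigma>"
  shows "\<exists>a b c p. is_pb \<Sigma> a b c p s u v t"
proof -
  have "is_pb \<Sigma> n n 1 n (opr n f) (opr n f) (ident n) (ident n)" if "f \<in> \<Sigma> n" for n f
    using that by (intro is_pb_mono opr_hom) (auto intro: opr_inject)
  moreover have "is_pb \<Sigma> 1 (n + 1) (1 + 1) n (dupl 1) (opr n f \<otimes> ident 1) (opr n f)
      (dupl n ;; (ident n \<otimes> opr n f))" if "f \<in> \<Sigma> n" for n f
    using that by (rule is_pb_sym[OF is_pb_D_op])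
  moreover have "is_pb \<Sigma> 1 1 (1 + 1) 1 (dupl 1) (dupl 1) (ident 1) (ident 1)"
    by (intro is_pb_mono dupl_hom) (metis seq_dupl pairing_inject)
  moreover have "is_pb \<Sigma> 2 2 2 2 (symm 1 1) (symm 1 1) (ident 2) (ident 2)"
  proof (intro is_pb_mono symm_1_1_hom)
    fix q and x y :: "'a arrow"
    have cancel: "z = (z ;; symm 1 1) ;; symm 1 1" if z: "z \<in> hom \<Sigma> q 2" for z
      unfolding seq_assoc[OF z symm_1_1_hom symm_1_1_hom] symm_1_1_seq seq_ident[OF z] ..
    assume "x \<in> hom \<Sigma> q 2" "y \<in> hom \<Sigma> q 2" "x ;; symm 1 1 = y ;; symm 1 1"
    with cancel[of x] cancel[of y] show "x = y"
      by argo
  qed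
  moreover note is_pb_D_op[of _ \<Sigma>] is_pb_D_dupl[of \<Sigma>]
  ultimately have *: "f \<in> \<Sigma> n \<Longrightarrow> \<exists>a b c p. is_pb \<Sigma> a b c p (opr n f) (opr n f) (ident n) (ident n)"
    "f \<in> \<Sigma> n \<Longrightarrow> \<exists>a b c p. is_pb \<Sigma> a b c p (dupl 1) (opr n f \<otimes> ident 1) (opr n f)
      (dupl n ;; (ident n \<otimes> opr n f))"
    "f \<in> \<Sigma> n \<Longrightarrow> \<exists>a b c p. is_pb \<Sigma> a b c p (opr n f \<otimes> ident 1) (dupl 1)
      (dupl n ;; (ident n \<otimes> opr n f)) (opr n f)"
    "\<exists>a b c p. is_pb \<Sigma> a b c p (dupl 1) (dupl 1) (ident 1) (ident 1)"
    "\<exists>a b c p. is_pb \<Sigma> a b c p (symm 1 1) (symm 1 1) (ident 2) (ident 2)"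
    "\<exists>a b c p. is_pb \<Sigma> a b c p (dupl 1 \<otimes> ident 1) (ident 1 \<otimes> dupl 1) (dupl 1) (dupl 1)"
    for n f by metis+
  show ?thesis
    using assms *
    unfolding pullback_basis_def R_op_def D_op_def D_hat_op_def R_dupl_def R_symm_def D_dupl_def
    by (elim UnE UN_E insertE emptyE Pair_inject) (simp_all only:)
qed

lemma gen_is_pb:
  assumes "(s, u, v, t) \<in> gen \<Sigma>"
  shows "\<exists>a b c p. is_pb \<Sigma> a b c p s u v t"
proof -
  \<comment> \<open>Projections let the induction run over an arbitrary cell. The objects stay
    existential and are matched by \<open>hom_unique\<close> at horizontal and vertical
    compositions.\<close>
  have "\<exists>a b c p. is_pb \<Sigma> a b c p (fst c') (fst (snd c')) (fst (snd (snd c'))) (snd (snd (snd c')))"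
    if "c' \<in> gen \<Sigma>" for c'
    using that
  proof induction
    case (basic c)
    then show ?case using pullback_basis_is_pb by (cases c) auto
  next
    case (ident_h h n m)
    then show ?case using is_pb_ident by fastforce
  next
    case (ident_v v n m)
    then show ?case using is_pb_ident[THEN is_pb_sym] by fastforce
  next
    case (horizontal s1 u1 v1 t1 s2 u2 v2 t2)
    then obtain a b c d a' b' c' d' where 1: "is_pb \<Sigma> a b c d s1 u1 v1 t1" and
      2: "is_pb \<Sigma> a' b' c' d' s2 v1 v2 t2" by auto
    moreover have "b' = d" "c' = a"
      using hom_unique[OF is_pb_homD(2)[OF 2] is_pb_homD(3)[OF 1]] by auto
    ultimately have "is_pb \<Sigma> a' b c d' (s2 ;; s1) u1 v2 (t2 ;; t1)"
      by (auto intro: is_pb_hcomp)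
    then show ?case by auto
  next
    case (vertical s1 u1 v1 t1 s2 u2 v2 t2)
    then obtain a b c d a' b' c' d' where 1: "is_pb \<Sigma> a b c d s1 u1 v1 t1" and
      2: "is_pb \<Sigma> a' b' c' d' t1 u2 v2 t2" by auto
    moreover have "a' = d" "c' = b"
      using hom_unique[OF is_pb_homD(1)[OF 2] is_pb_homD(4)[OF 1]] by auto
    ultimately have "is_pb \<Sigma> a b' c d' s1 (u2 ;; u1) (v2 ;; v1) t2"
      by (auto intro: is_pb_vcomp)
    then show ?case by auto
  next
    case (parallel c d)
    obtain s u v t s' u' v' t' where "c = (s, u, v, t)" "d = (s', u', v', t')"
      by (metis prod_cases4)
    with parallel.IH show ?case
      by simp (metis is_pb_tensor)
  qed
  from this[OF assms] show ?thesis by simp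
qed

lemma gen_is_pb_typed:
  assumes "(s, u, v, t) \<in> gen \<Sigma>" "s \<in> hom \<Sigma> a c" "u \<in> hom \<Sigma> b c"
  obtains p where "is_pb \<Sigma> a b c p s u v t"
  using gen_is_pb[OF assms(1)] assms(2,3) by (metis hom_unique is_pb_homD(1,2))


subsection \<open>Invertible arrows\<close>

lemma gen_hcomp:
  "\<lbrakk>(s1, u1, v1, t1) \<in> gen \<Sigma>; (s2, v1, v2, t2) \<in> gen \<Sigma>\<rbrakk> \<Longrightarrow> (s2 ;; s1, u1, v2, t2 ;; t1) \<in> gen \<Sigma>"
  using generated.horizontal by fastforce

lemma gen_vcomp:
  "\<lbrakk>(s1, u1, v1, t1) \<in> gen \<Sigma>; (t1, u2, v2, t2) \<in> gen \<Sigma>\<rbrakk> \<Longrightarrow> (s1, u2 ;; u1, v2 ;; v1, t2) \<in> gen \<Sigma>"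
  using generated.vertical by fastforce

lemma gen_tensor:
  "\<lbrakk>(s, u, v, t) \<in> gen \<Sigma>; (s', u', v', t') \<in> gen \<Sigma>\<rbrakk>
    \<Longrightarrow> (s \<otimes> s', u \<otimes> u', v \<otimes> v', t \<otimes> t') \<in> gen \<Sigma>"
  using generated.parallel by fastforce

text \<open>Besides invertibility, both directions must occur in generated cells over a cospan of
  identities, because such cells change the apex of another cell. By
  \<open>gen_iso_inverse_arrows\<close> every isomorphism qualifies.\<close>

definition gen_iso :: "'f signature \<Rightarrow> nat \<Rightarrow> 'f arrow \<Rightarrow> 'f arrow \<Rightarrow> bool" where
  "gen_iso \<Sigma> n h k \<longleftrightarrow> h \<in> hom \<Sigma> n n \<and> k \<in> hom \<Sigma> n n \<and> h ;; k = ident n \<and> k ;; h = ident n \<and>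
     (ident n, ident n, h, h) \<in> gen \<Sigma> \<and> (ident n, ident n, k, k) \<in> gen \<Sigma>"

lemma gen_isoD:
  assumes "gen_iso \<Sigma> n h k"
  shows "h \<in> hom \<Sigma> n n" "k \<in> hom \<Sigma> n n" "h ;; k = ident n" "k ;; h = ident n"
    "(ident n, ident n, h, h) \<in> gen \<Sigma>" "(ident n, ident n, k, k) \<in> gen \<Sigma>"
  using assms by (auto simp: gen_iso_def)

lemma gen_iso_sym: "gen_iso \<Sigma> n h k \<Longrightarrow> gen_iso \<Sigma> n k h"
  by (auto simp: gen_iso_def)

text \<open>The identity cell on \<open>t\<close> and the cell of \<open>h\<close> compose
  horizontally to \<open>(t, ident b, h, h ;; t)\<close>, which is then composed vertically with the
  given cell.\<close>

lemma gen_precomp: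
  assumes c: "(s, u, v, t) \<in> gen \<Sigma>" and u: "u \<in> hom \<Sigma> b c" and t: "t \<in> hom \<Sigma> p b"
    and h: "(ident p, ident p, h, h) \<in> gen \<Sigma>"
  shows "(s, u, h ;; v, h ;; t) \<in> gen \<Sigma>"
  using gen_vcomp[OF c gen_hcomp[OF generated.ident_h[OF t] h, unfolded ident_seq[OF t]]]
  by (simp add: ident_seq[OF u])

lemma gen_iso_ident: "gen_iso \<Sigma> n (ident n) (ident n)"
  by (auto simp: gen_iso_def ident_hom ident_seq[OF ident_hom] intro: generated.ident_h)

lemma gen_iso_seq:
  assumes 1: "gen_iso \<Sigma> n h k" and 2: "gen_iso \<Sigma> n h' k'"
  shows "gen_iso \<Sigma> n (h ;; h') (k' ;; k)"
proof -
  note hs = gen_isoD[OF 1] gen_isoD[OF 2]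
  have "(h ;; h') ;; (k' ;; k) = ident n"
    using seq_assoc[OF hs(1) hs(7) seq_hom[OF hs(8) hs(2)]] seq_assoc[OF hs(7) hs(8) hs(2)] hs
    by (simp add: ident_seq)
  moreover have "(k' ;; k) ;; (h ;; h') = ident n"
    using seq_assoc[OF hs(8) hs(2) seq_hom[OF hs(1) hs(7)]] seq_assoc[OF hs(2) hs(1) hs(7)] hs
    by (simp add: ident_seq)
  ultimately show ?thesis
    using hs by (auto simp: gen_iso_def intro: seq_hom gen_precomp ident_hom)
qed

lemma gen_iso_tensor:
  assumes "gen_iso \<Sigma> n h k" "gen_iso \<Sigma> n' h' k'"
  shows "gen_iso \<Sigma> (n + n') (h \<otimes> h') (k \<otimes> k')"
  using assms gen_tensor[of "ident n" "ident n" h h \<Sigma> "ident n'" "ident n'" h' h']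
    gen_tensor[of "ident n" "ident n" k k \<Sigma> "ident n'" "ident n'" k' k']
  by (auto simp: gen_iso_def tensor_hom tensor_seq ident_tensor_ident)

text \<open>With a bit per side recording whether it is the transposition \<open>\<gamma>\<close> or the identity,
  cells with invertible sides compose as
  \<open>1010 = 1100 \<cdot> 0110\<close>, \<open>0101 = 1100 * 1001\<close>, \<open>1111 = 0101 * 1010\<close>, \<open>0011 = 1010 * 1111\<close>.\<close>

lemma gen_iso_symm: "gen_iso \<Sigma> 2 (symm 1 1) (symm 1 1)"
proof -
  let ?g = "symm 1 1 :: 'a arrow" and ?i = "ident 2 :: 'a arrow"
  have s: "?g ;; ?i = ?g" "?i ;; ?g = ?g" "?g ;; ?g = ?i" "?i ;; ?i = ?i"
    using seq_ident[OF symm_1_1_hom] ident_seq[OF symm_1_1_hom] symm_1_1_seq ident_seq[OF ident_hom]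
    by auto
  have R: "(?g, ?g, ?i, ?i) \<in> gen \<Sigma>"
    by (rule generated.basic) (simp add: pullback_basis_def R_symm_def)
  have 1: "(?g, ?i, ?g, ?i) \<in> gen \<Sigma>"
    using gen_vcomp[OF R generated.ident_v[OF symm_1_1_hom]] by (simp only: s)
  have 2: "(?i, ?g, ?i, ?g) \<in> gen \<Sigma>"
    using gen_hcomp[OF R generated.ident_h[OF symm_1_1_hom]] by (simp only: s)
  have 3: "(?g, ?g, ?g, ?g) \<in> gen \<Sigma>"
    using gen_hcomp[OF 2 1] by (simp only: s)
  have "(?i, ?i, ?g, ?g) \<in> gen \<Sigma>"
    using gen_hcomp[OF 1 3] by (simp only: s)
  then show ?thesis
    using symm_1_1_hom s by (auto simp: gen_iso_def)
qed

section \<open>Transport of generated cells along isomorphisms\<close>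

text \<open>Pulling back along an isomorphism keeps the apex \<open>b\<close>. The case
  \<open>u = ident n\<close> is composed from an identity cell and the cell of \<open>k\<close>; a
  vertical identity cell extends it to any \<open>u\<close>.\<close>

lemma gen_iso_left:
  assumes "gen_iso \<Sigma> n h k" and u: "u \<in> hom \<Sigma> b n"
  shows "(h, u, u ;; k, ident b) \<in> gen \<Sigma>"
proof -
  note hs = gen_isoD[OF assms(1)]
  have "(h, ident n, k, ident n) \<in> gen \<Sigma>"
    using gen_hcomp[OF generated.ident_h[of h \<Sigma> n n] , of "ident n" k k] hs by (simp add: ident_seq)
  from gen_vcomp[OF this generated.ident_v[OF u]] show ?thesis
    using u by (simp add: seq_ident)
qed

lemma gen_iso_right:
  assumes "gen_iso \<Sigma> n h k" and s: "s \<in> hom \<Sigma> a n"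
  shows "(s, h, ident a, s ;; k) \<in> gen \<Sigma>"
proof -
  note hs = gen_isoD[OF assms(1)]
  have "(ident n, h, ident n, k) \<in> gen \<Sigma>"
    using gen_vcomp[OF generated.ident_v[of h \<Sigma> n n], of "ident n" k k] hs by (simp add: ident_seq)
  from gen_hcomp[OF this generated.ident_h[OF s]] show ?thesis
    using s by (simp add: seq_ident)
qed

lemma gen_left_precomp:
  assumes "(s, u, v, t) \<in> gen \<Sigma>" "v \<in> hom \<Sigma> p a" "t \<in> hom \<Sigma> p b" "gen_iso \<Sigma> a h k"
  shows "(h ;; s, u, v ;; k, t) \<in> gen \<Sigma>"
  using gen_hcomp[OF assms(1) gen_iso_left[OF assms(4,2)]] assms(3) by (simp add: ident_seq)

lemma gen_right_precomp:
  assumes "(s, u, v, t) \<in> gen \<Sigma>" "v \<in> hom \<Sigma> p a" "t \<in> hom \<Sigma> p b" "gen_iso \<Sigma> b h k"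
  shows "(s, h ;; u, v, t ;; k) \<in> gen \<Sigma>"
  using gen_vcomp[OF assms(1) gen_iso_right[OF assms(4,3)]] assms(2) by (simp add: ident_seq)

text \<open>An isomorphism at the common target leaves the legs of a pullback alone; the cell
  \<open>(h, h, ident c, ident c)\<close> comes from \<open>gen_iso_left\<close> with
  \<open>u = h\<close>.\<close>

lemma gen_postcomp:
  assumes c: "(s, u, v, t) \<in> gen \<Sigma>" and s: "s \<in> hom \<Sigma> a c" and v: "v \<in> hom \<Sigma> p a"
    and h: "gen_iso \<Sigma> c h k"
  shows "(s ;; h, u ;; h, v, t) \<in> gen \<Sigma>"
proof -
  have "(h, h, ident c, ident c) \<in> gen \<Sigma>"
    using gen_iso_left[OF h, of h c] h by (simp add: gen_iso_def)
  from gen_hcomp[OF this generated.ident_h[OF s]] have "(s ;; h, h, ident a, s) \<in> gen \<Sigma>"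
    using s by (simp add: seq_ident)
  from gen_vcomp[OF this c] show ?thesis
    using v by (simp add: seq_ident)
qed

section \<open>Permutations as composites of adjacent swaps\<close>

text \<open>By induction \<open>y\<close> passes \<open>xs\<close>, and one \<open>symm 1 1\<close>
  then takes it past \<open>x\<close>. Arbitrary terms as components, instead of an identity tuple,
  keep the statement closed under passing to the tail.\<close>

lemma move_to_front:
  assumes "Arrow q (xs @ y # ys) \<in> hom \<Sigma> q n"
  shows "\<exists>h k. gen_iso \<Sigma> n h k \<and> Arrow q (xs @ y # ys) ;; h = Arrow q (y # xs @ ys)"
  using assms
proof (induction xs arbitrary: n)
  case Nil
  then show ?case using gen_iso_ident seq_ident by fastforce
next
  case (Cons x xs)
  define m where "m = length xs + length ys"
  have n: "n = 1 + (1 + m)" and x: "Arrow q [x] \<in> hom \<Sigma> q 1" and y: "Arrow q [y] \<in> hom \<Sigma> q 1"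
    and xs: "Arrow q (xs @ y # ys) \<in> hom \<Sigma> q (1 + m)" and r: "Arrow q (xs @ ys) \<in> hom \<Sigma> q m"
    and xy: "Arrow q [x, y] \<in> hom \<Sigma> q 2"
    using Cons.prems by (auto simp: hom_def m_def)
  from Cons.IH[OF xs] obtain h k where h: "gen_iso \<Sigma> (1 + m) h k"
    and eq: "Arrow q (xs @ y # ys) ;; h = Arrow q (y # xs @ ys)" by blast
  let ?h1 = "ident 1 \<otimes> h" and ?h2 = "symm 1 1 \<otimes> ident m"
  have h1: "gen_iso \<Sigma> n ?h1 (ident 1 \<otimes> k)"
    using gen_iso_tensor[OF gen_iso_ident[of _ 1] h] n by simp
  have h2: "gen_iso \<Sigma> n ?h2 ?h2"
    using gen_iso_tensor[OF gen_iso_symm gen_iso_ident, of \<Sigma> m] n by simp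
  have e1: "Arrow q (x # xs @ y # ys) ;; ?h1 = Arrow q (x # y # xs @ ys)"
    using pairing_tensor[OF x xs ident_hom, of h "1 + m"] h eq seq_ident[OF x]
    by (simp add: gen_iso_def pairing_def)
  have e2: "Arrow q [x, y] ;; symm 1 1 = Arrow q [y, x]"
    by (simp add: seq_def symm_def)
  have e3: "Arrow q (x # y # xs @ ys) ;; ?h2 = Arrow q (y # x # xs @ ys)"
    using pairing_tensor[OF xy r symm_1_1_hom ident_hom] e2 seq_ident[OF r]
    by (simp add: pairing_def)
  have "Arrow q (x # xs @ y # ys) ;; (?h1 ;; ?h2) = Arrow q (y # x # xs @ ys)"
    using seq_assoc[of "Arrow q (x # xs @ y # ys)" \<Sigma> q n ?h1 n ?h2 n] Cons.prems h1 h2 e1 e3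
    by (simp add: gen_iso_def)
  then show ?case
    using gen_iso_seq[OF h1 h2] by auto
qed

text \<open>Selection sort: the required first entry is moved to the front, and the rest is sorted
  next to \<open>ident 1\<close>.\<close>

lemma permute_components:
  assumes "Arrow q xs \<in> hom \<Sigma> q n" "mset xs = mset ys"
  shows "\<exists>h k. gen_iso \<Sigma> n h k \<and> Arrow q xs ;; h = Arrow q ys"
  using assms
proof (induction ys arbitrary: xs n)
  case Nil
  then show ?case using gen_iso_ident seq_ident by fastforce
next
  case (Cons y ys)
  then obtain as bs where xs: "xs = as @ y # bs"
    by (metis list.set_intros(1) mset_eq_setD split_list)
  define m where "m = length as + length bs"
  have n: "n = 1 + m" and y: "Arrow q [y] \<in> hom \<Sigma> q 1" and r: "Arrow q (as @ bs) \<in> hom \<Sigma> q m"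
    using Cons.prems xs by (auto simp: hom_def m_def)
  from Cons.prems xs obtain h1 k1 where h1: "gen_iso \<Sigma> n h1 k1"
    and e1: "Arrow q xs ;; h1 = Arrow q (y # as @ bs)" using move_to_front by blast
  from Cons.IH[OF r] Cons.prems xs obtain h2 k2 where h2: "gen_iso \<Sigma> m h2 k2"
    and e2: "Arrow q (as @ bs) ;; h2 = Arrow q ys" by auto
  let ?h2 = "ident 1 \<otimes> h2"
  have h2': "gen_iso \<Sigma> n ?h2 (ident 1 \<otimes> k2)"
    using gen_iso_tensor[OF gen_iso_ident[of _ 1] h2] n by simp
  have e2': "Arrow q (y # as @ bs) ;; ?h2 = Arrow q (y # ys)"
    using pairing_tensor[OF y r ident_hom, of h2 m] h2 e2 seq_ident[OF y]
    by (simp add: gen_iso_def pairing_def)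
  have "Arrow q xs ;; (h1 ;; ?h2) = Arrow q (y # ys)"
    using seq_assoc[of "Arrow q xs" \<Sigma> q n h1 n ?h2 n] Cons.prems h1 h2' e1 e2'
    by (simp add: gen_iso_def)
  then show ?case
    using gen_iso_seq[OF h1 h2'] by auto
qed

lemma gen_iso_permutation:
  assumes "distinct xs" "set xs = {..<n}"
  obtains k where "gen_iso \<Sigma> n (Arrow n (map Var xs)) k"
proof -
  have "set [0..<n] = set xs" "distinct [0..<n]"
    by (simp_all only: assms(2) set_upt atLeast0LessThan distinct_upt)
  then have "mset [0..<n] = mset xs"
    using assms(1) set_eq_iff_mset_eq_distinct by blast
  then have "mset (map Var [0..<n]) = mset (map Var xs)"
    by (metis mset_map)
  from permute_components[OF ident_hom[of n \<Sigma>, unfolded ident_def] this] obtain h k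
    where "gen_iso \<Sigma> n h k" "ident n ;; h = Arrow n (map Var xs)"
    unfolding ident_def by blast
  then show ?thesis
    using that by (metis gen_iso_def ident_seq)
qed

section \<open>Every isomorphism is a permutation\<close>

text \<open>A term that a substitution turns into a variable is itself a variable. Recording
  \<open>comps k ! f i = Var i\<close> as well makes \<open>f\<close> injective.\<close>

lemma right_inverse_variables:
  assumes h: "h \<in> hom \<Sigma> n m" and kh: "k ;; h = ident m" and k: "k \<in> hom \<Sigma> m n"
  obtains xs where "h = Arrow n (map Var xs)" "distinct xs" "set xs \<subseteq> {..<n}" "length xs = m"
proof -
  have "\<exists>j<n. comps h ! i = Var j \<and> comps k ! j = Var i" if "i < m" for i
  proof -
    have "subst (\<lambda>i. comps k ! i) (comps h ! i) = Var i" "is_trm \<Sigma> n (comps h ! i)"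
      using that h arg_cong[OF kh, of "\<lambda>a. comps a ! i"] by (auto simp: seq_def ident_def hom_def)
    then show ?thesis by (cases "comps h ! i") auto
  qed
  then obtain f where f: "\<And>i. i < m \<Longrightarrow> f i < n \<and> comps h ! i = Var (f i) \<and> comps k ! f i = Var i"
    by metis
  show ?thesis
  proof
    show "h = Arrow n (map Var (map f [0..<m]))"
      using h f by (cases h) (auto simp: hom_def intro!: nth_equalityI)
    show "distinct (map f [0..<m])"
      unfolding distinct_map by (auto intro!: inj_onI) (metis f trm.inject(1))
  qed (use f in auto)
qed

text \<open>The two directions give duplicate-free lists of variables, hence
  \<open>m \<le> n\<close> and \<open>n \<le> m\<close>; so the list of \<open>h\<close> exhausts
  the source.\<close>

lemma gen_iso_inverse_arrows:
  assumes h: "h \<in> hom \<Sigma> n m" and k: "k \<in> hom \<Sigma> m n" and "h ;; k = ident n" "k ;; h = ident m"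
  shows "n = m \<and> (\<exists>k. gen_iso \<Sigma> n h k)"
proof -
  obtain xs where xs: "h = Arrow n (map Var xs)" "distinct xs" "set xs \<subseteq> {..<n}" "length xs = m"
    using right_inverse_variables assms by metis
  obtain ys where ys: "distinct ys" "set ys \<subseteq> {..<m}" "length ys = n"
    using right_inverse_variables assms by metis
  have "card (set xs) \<le> n" "card (set ys) \<le> m"
    using card_mono[OF _ xs(3)] card_mono[OF _ ys(2)] by auto
  then have "n = m" using xs ys by (simp add: distinct_card)
  moreover from this have "set xs = {..<n}"
    using xs by (intro card_subset_eq) (auto simp: distinct_card)
  ultimately show ?thesis
    using gen_iso_permutation xs by metis
qed


subsection \<open>Relevant arrows\<close>

fun tvars :: "'f trm \<Rightarrow> nat set" where
  "tvars (Var i) = {i}"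
| "tvars (App f ts) = (\<Union>t\<in>set ts. tvars t)"

lemma tvars_subst: "tvars (subst \<sigma> t) = (\<Union>i\<in>tvars t. tvars (\<sigma> i))"
  by (induction t) auto

lemma subst_cong_tvars: "(\<And>i. i \<in> tvars t \<Longrightarrow> \<sigma> i = \<tau> i) \<Longrightarrow> subst \<sigma> t = subst \<tau> t"
  by (induction t) auto

lemma is_trm_tvars: "is_trm \<Sigma> n t \<Longrightarrow> tvars t \<subseteq> {..<n}"
  by (induction t) auto

lemma finite_tvars: "finite (tvars t)"
  by (induction t) auto

definition avars :: "'f arrow \<Rightarrow> nat set" where
  "avars a = (\<Union>t\<in>set (comps a). tvars t)"

text \<open>Relevant as in relevance logic: nothing is discarded. For arrows in \<open>hom\<close>
  the inclusion is an equality by \<open>avars_hom\<close>.\<close>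

definition relevant :: "'f arrow \<Rightarrow> bool" where
  "relevant a \<longleftrightarrow> {..<src a} \<subseteq> avars a"

lemma avars_hom: "a \<in> hom \<Sigma> n m \<Longrightarrow> avars a \<subseteq> {..<n}"
  using is_trm_tvars by (fastforce simp: hom_def avars_def)

lemma avars_seq: "avars (a ;; b) = (\<Union>i\<in>avars b. tvars (comps a ! i))"
  by (auto simp: avars_def seq_def tvars_subst)

lemma avars_seq_subset:
  assumes "a \<in> hom \<Sigma> n k" "b \<in> hom \<Sigma> k m"
  shows "avars (a ;; b) \<subseteq> avars a"
proof
  fix j assume "j \<in> avars (a ;; b)"
  then obtain i where "i \<in> avars b" "j \<in> tvars (comps a ! i)"
    by (auto simp: avars_seq)
  moreover from this have "i < length (comps a)"
    using assms(1) avars_hom[OF assms(2)] by (auto simp: hom_def)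
  ultimately show "j \<in> avars a"
    unfolding avars_def using nth_mem by blast
qed

lemma avars_seq_relevant:
  assumes "a \<in> hom \<Sigma> n k" "b \<in> hom \<Sigma> k m" "relevant b"
  shows "avars (a ;; b) = avars a"
proof
  show "avars (a ;; b) \<subseteq> avars a"
    using assms avars_seq_subset by blast
  show "avars a \<subseteq> avars (a ;; b)"
  proof
    fix j assume "j \<in> avars a"
    then obtain i where "i < length (comps a)" "j \<in> tvars (comps a ! i)"
      by (auto simp: avars_def in_set_conv_nth)
    moreover from this have "i \<in> avars b"
      using assms by (auto simp: hom_def relevant_def)
    ultimately show "j \<in> avars (a ;; b)"
      by (auto simp: avars_seq)
  qed
qed

lemma relevant_seqD:
  assumes "relevant (a ;; b)" "a \<in> hom \<Sigma> n k" "b \<in> hom \<Sigma> k m"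
  shows "relevant a"
  using assms avars_seq_subset[OF assms(2,3)] by (auto simp: relevant_def seq_def)

lemma relevant_ident: "relevant (ident n)"
  by (auto simp: relevant_def avars_def ident_def)

lemma relevant_opr: "relevant (opr n f)"
  by (auto simp: relevant_def avars_def opr_def)

lemma relevant_dupl: "relevant (dupl n)"
  by (auto simp: relevant_def avars_def dupl_def)

lemma relevant_tensor:
  assumes "relevant a" "relevant b"
  shows "relevant (a \<otimes> b)"
proof -
  have "avars (a \<otimes> b) = avars a \<union> (\<lambda>i. src a + i) ` avars b"
    by (auto simp: avars_def tensor_def tvars_subst)
  moreover have "i \<in> (\<lambda>i. src a + i) ` avars b" if "\<not> i < src a" "i < src a + src b" for i
    using that assms(2) unfolding relevant_def
    by (intro image_eqI[of _ _ "i - src a"]) auto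
  ultimately show ?thesis
    using assms(1) by (fastforce simp: relevant_def tensor_def)
qed

lemma relevant_gen_iso:
  assumes "gen_iso \<Sigma> n h k"
  shows "relevant h"
  using relevant_seqD[of h k \<Sigma> n n n] gen_isoD[OF assms] relevant_ident by metis

text \<open>As \<open>s\<close> and \<open>u\<close> are relevant, \<open>v\<close> and
  \<open>t\<close> use the same variables. A variable missing from both could be changed without
  affecting either leg, against joint monicity.\<close>

lemma is_pb_relevant:
  fixes \<Sigma> :: "'f signature"
  assumes pb: "is_pb \<Sigma> a b c p s u v t" and s: "relevant s" and u: "relevant u"
  shows "relevant v"
proof -
  note h = is_pb_homD[OF pb]
  have eq: "avars v = avars t"
    using avars_seq_relevant[OF h(3,1) s] avars_seq_relevant[OF h(4,2) u] h(5) by simp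
  have "i \<in> avars v" if i: "i < p" for i
  proof (rule ccontr)
    assume ni: "i \<notin> avars v"
    \<comment> \<open>Two arrows out of \<open>p + 1\<close> that differ only at position
      \<open>i\<close>, where the second has the extra variable with index \<open>p\<close>.\<close>
    let ?f = "Arrow (p + 1) (map Var [0..<p]) :: 'f arrow"
      and ?g = "Arrow (p + 1) (map Var ([0..<p][i := p])) :: 'f arrow"
    have f: "?f \<in> hom \<Sigma> (p + 1) p" and g: "?g \<in> hom \<Sigma> (p + 1) p"
      using set_update_subset_insert[of "[0..<p]" i p] by (auto simp: hom_def)
    have agree: "?f ;; w = ?g ;; w" if w: "w \<in> hom \<Sigma> p d" and iw: "i \<notin> avars w" for w d
    proof -
      have "subst (\<lambda>j. comps ?f ! j) r = subst (\<lambda>j. comps ?g ! j) r" if r: "r \<in> set (comps w)" for r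
      proof (rule subst_cong_tvars)
        fix j assume j: "j \<in> tvars r"
        then have "j \<in> avars w" using r by (auto simp: avars_def)
        then have "j \<noteq> i" "j < p" using iw avars_hom[OF w] by auto
        then show "comps ?f ! j = comps ?g ! j" by (simp add: i)
      qed
      then show ?thesis by (simp add: seq_def)
    qed
    have "?f = ?g"
      by (rule is_pb_unique[OF pb f g agree[OF h(3) ni] agree[OF h(4) ni[unfolded eq]]])
    then have "comps ?f ! i = comps ?g ! i" by simp
    with i show False by simp
  qed
  then show ?thesis
    using h(3) by (auto simp: relevant_def hom_def)
qed


subsection \<open>Size\<close>

text \<open>Variables have size 1, not 0, so that duplicating one strictly increases the
  size.\<close>

fun tsize :: "'f trm \<Rightarrow> nat" where
  "tsize (Var i) = 1"
| "tsize (App f ts) = Suc (sum_list (map tsize ts))"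

definition asize :: "'f arrow \<Rightarrow> nat" where
  "asize a = sum_list (map tsize (comps a))"

lemma tsize_pos: "tsize t > 0"
  by (cases t) auto

lemma asize_pairing: "asize (pairing x y) = asize x + asize y"
  by (simp add: asize_def pairing_def)

lemma sum_UN_list_le:
  fixes g :: "'b \<Rightarrow> nat"
  assumes "\<And>x. x \<in> set xs \<Longrightarrow> finite (A x)"
  shows "sum g (\<Union>x\<in>set xs. A x) \<le> sum_list (map (\<lambda>x. sum g (A x)) xs)"
  using assms
proof (induction xs)
  case (Cons x xs)
  have "sum g (A x \<union> (\<Union>x\<in>set xs. A x)) \<le> sum g (A x) + sum g (\<Union>x\<in>set xs. A x)"
    using Cons.prems sum.union_inter[of "A x" "\<Union>x\<in>set xs. A x" g] by simp
  with Cons show ?case by fastforce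
qed simp

text \<open>Each variable of \<open>t\<close> contributes at least one copy of its image; repeated
  occurrences only enlarge the right-hand side.\<close>

lemma tsize_subst_ge: "(\<Sum>i\<in>tvars t. tsize (\<sigma> i)) \<le> tsize (subst \<sigma> t)"
proof (induction t)
  case (App f ts)
  have "(\<Sum>i\<in>tvars (App f ts). tsize (\<sigma> i)) \<le> sum_list (map (\<lambda>t. \<Sum>i\<in>tvars t. tsize (\<sigma> i)) ts)"
    unfolding tvars.simps by (rule sum_UN_list_le) (rule finite_tvars)
  also have "\<dots> \<le> sum_list (map (\<lambda>t. tsize (subst \<sigma> t)) ts)"
    using App by (intro sum_list_mono) auto
  finally show ?case by (simp add: comp_def)
qed simp

text \<open>Relevance puts every source variable of \<open>b\<close> into the sum, so each component
  of \<open>a\<close> is counted at least once in the composite.\<close>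

lemma asize_seq_mono:
  assumes a: "a \<in> hom \<Sigma> n k" and b: "b \<in> hom \<Sigma> k m" and r: "relevant b"
  shows "asize a \<le> asize (a ;; b)"
proof -
  have "avars b = {..<k}"
    using avars_hom[OF b] r b by (auto simp: relevant_def hom_def)
  moreover have "asize a = (\<Sum>i<k. tsize (comps a ! i))"
    using a by (auto simp: asize_def hom_def sum_list_sum_nth atLeast0LessThan)
  ultimately have "asize a = (\<Sum>i\<in>avars b. tsize (comps a ! i))"
    by simp
  also have "\<dots> \<le> sum_list (map (\<lambda>t. \<Sum>i\<in>tvars t. tsize (comps a ! i)) (comps b))"
    unfolding avars_def by (rule sum_UN_list_le) (rule finite_tvars)
  also have "\<dots> \<le> asize (a ;; b)"
    unfolding asize_def seq_def by (auto simp: comp_def intro!: sum_list_mono tsize_subst_ge)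
  finally show ?thesis .
qed


subsection \<open>Elementary arrows\<close>

text \<open>The strict inequality is built in so that one grid argument serves operations,
  duplicators and their tensors with identities.\<close>

definition elementary :: "'f signature \<Rightarrow> 'f arrow \<Rightarrow> nat \<Rightarrow> nat \<Rightarrow> bool" where
  "elementary \<Sigma> e a b \<longleftrightarrow> e \<in> hom \<Sigma> a b \<and> relevant e \<and>
     (\<forall>q. \<forall>z\<in>hom \<Sigma> q a. asize z < asize (z ;; e))"

lemma seq_opr: "z \<in> hom \<Sigma> q n \<Longrightarrow> z ;; opr n f = Arrow q [App f (comps z)]"
  by (auto simp: hom_def seq_def opr_def intro!: nth_equalityI)

text \<open>The new symbol adds one, also for constants, where \<open>z\<close> has size 0.\<close>

lemma elementary_opr: "f \<in> \<Sigma> n \<Longrightarrow> elementary \<Sigma> (opr n f) n 1"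
  unfolding elementary_def
  by (intro conjI allI ballI opr_hom relevant_opr) (simp_all add: seq_opr asize_def)

lemma elementary_dupl: "elementary \<Sigma> (dupl 1) 1 2"
  unfolding elementary_def
proof (intro conjI allI ballI relevant_dupl)
  show "dupl 1 \<in> hom \<Sigma> 1 2"
    using dupl_hom[of 1 \<Sigma>] by (simp only: one_add_one)
  fix q and z :: "'a arrow" assume z: "z \<in> hom \<Sigma> q 1"
  then obtain t where "comps z = [t]"
    by (auto simp: hom_def length_Suc_conv)
  then have "asize z > 0"
    using tsize_pos by (simp add: asize_def)
  then show "asize z < asize (z ;; dupl 1)"
    unfolding seq_dupl[OF z] asize_pairing by simp
qed

lemma elementary_tensor_ident:
  assumes "elementary \<Sigma> e a b"
  shows "elementary \<Sigma> (e \<otimes> ident r) (a + r) (b + r)"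
  unfolding elementary_def
proof (intro conjI allI ballI)
  have e: "e \<in> hom \<Sigma> a b" "relevant e" "\<And>q z. z \<in> hom \<Sigma> q a \<Longrightarrow> asize z < asize (z ;; e)"
    using assms by (auto simp: elementary_def)
  show "e \<otimes> ident r \<in> hom \<Sigma> (a + r) (b + r)" "relevant (e \<otimes> ident r)"
    using e by (auto intro: tensor_hom ident_hom relevant_tensor relevant_ident)
  fix q z assume "z \<in> hom \<Sigma> q (a + r)"
  then obtain x y where x: "x \<in> hom \<Sigma> q a" "y \<in> hom \<Sigma> q r" "z = pairing x y"
    by (rule pairing_cases)
  then show "asize z < asize (z ;; (e \<otimes> ident r))"
    using pairing_tensor[OF x(1,2) e(1) ident_hom] e(3)[OF x(1)] seq_ident[OF x(2)]
    by (simp add: asize_pairing)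
qed

lemma elementary_ident_tensor:
  assumes "elementary \<Sigma> e a b"
  shows "elementary \<Sigma> (ident r \<otimes> e) (r + a) (r + b)"
  unfolding elementary_def
proof (intro conjI allI ballI)
  have e: "e \<in> hom \<Sigma> a b" "relevant e" "\<And>q z. z \<in> hom \<Sigma> q a \<Longrightarrow> asize z < asize (z ;; e)"
    using assms by (auto simp: elementary_def)
  show "ident r \<otimes> e \<in> hom \<Sigma> (r + a) (r + b)" "relevant (ident r \<otimes> e)"
    using e by (auto intro: tensor_hom ident_hom relevant_tensor relevant_ident)
  fix q z assume "z \<in> hom \<Sigma> q (r + a)"
  then obtain x y where x: "x \<in> hom \<Sigma> q r" "y \<in> hom \<Sigma> q a" "z = pairing x y"
    by (rule pairing_cases)
  then show "asize z < asize (z ;; (ident r \<otimes> e))"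
    using pairing_tensor[OF x(1,2) ident_hom e(1)] e(3)[OF x(2)] seq_ident[OF x(1)]
    by (simp add: asize_pairing)
qed


subsection \<open>Completing cospans of relevant arrows\<close>

definition completable :: "'f signature \<Rightarrow> 'f arrow \<Rightarrow> 'f arrow \<Rightarrow> bool" where
  "completable \<Sigma> s u \<longleftrightarrow> (\<exists>v t. (s, u, v, t) \<in> gen \<Sigma>)"

text \<open>The hypothesis of the size induction as a predicate, so that the grid can be stated
  separately. The source \<open>q\<close> is fixed because all subproblems inherit their cones from
  a single one.\<close>

definition completable_below :: "'f signature \<Rightarrow> nat \<Rightarrow> nat \<Rightarrow> bool" where
  "completable_below \<Sigma> q N \<longleftrightarrow> (\<forall>a b c s u x y. s \<in> hom \<Sigma> a c \<longrightarrow> u \<in> hom \<Sigma> b c \<longrightarrow>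
     relevant s \<longrightarrow> relevant u \<longrightarrow> x \<in> hom \<Sigma> q a \<longrightarrow> y \<in> hom \<Sigma> q b \<longrightarrow> y ;; u = x ;; s \<longrightarrow>
     asize (x ;; s) < N \<longrightarrow> completable \<Sigma> s u)"

text \<open>The completing cell is a pullback of relevant arrows, so it returns relevant legs and a
  factor \<open>h\<close> of the cone: what is needed to pose the next subproblem.\<close>

lemma completable_belowE:
  assumes "completable_below \<Sigma> q N" "s \<in> hom \<Sigma> a c" "u \<in> hom \<Sigma> b c" "relevant s" "relevant u"
    "x \<in> hom \<Sigma> q a" "y \<in> hom \<Sigma> q b" "y ;; u = x ;; s" "asize (x ;; s) < N"
  obtains v t p h where "(s, u, v, t) \<in> gen \<Sigma>" "v \<in> hom \<Sigma> p a" "t \<in> hom \<Sigma> p b" "relevant v"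
    "relevant t" "h \<in> hom \<Sigma> q p" "h ;; v = x" "h ;; t = y"
proof -
  have "completable \<Sigma> s u"
    using assms(1)[unfolded completable_below_def, rule_format, OF assms(2-)] .
  then obtain v t where c: "(s, u, v, t) \<in> gen \<Sigma>"
    by (auto simp: completable_def)
  obtain p where pb: "is_pb \<Sigma> a b c p s u v t"
    using gen_is_pb_typed[OF c assms(2,3)] .
  obtain h where h: "h \<in> hom \<Sigma> q p" "h ;; v = x" "h ;; t = y"
    using is_pb_factor[OF pb assms(6-8)] .
  show ?thesis
    using that[OF c is_pb_homD(3,4)[OF pb] is_pb_relevant[OF pb assms(4,5)]
        is_pb_relevant[OF is_pb_sym[OF pb] assms(5,4)] h] .
qed

text \<open>Four cells in a two-by-two grid: the corner is given, the other three come from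
  smaller instances because the common value loses an elementary arrow.\<close>

lemma completable_grid:
  assumes below: "completable_below \<Sigma> q N" and cell: "(e1, e2, v1, t1) \<in> gen \<Sigma>"
    and e1: "elementary \<Sigma> e1 a' c" and e2: "elementary \<Sigma> e2 b' c"
    and s: "s \<in> hom \<Sigma> a a'" "relevant s" and u: "u \<in> hom \<Sigma> b b'" "relevant u"
    and x: "x \<in> hom \<Sigma> q a" and y: "y \<in> hom \<Sigma> q b"
    and eq: "y ;; (u ;; e2) = x ;; (s ;; e1)" and N: "asize (x ;; (s ;; e1)) \<le> N"
  shows "completable \<Sigma> (s ;; e1) (u ;; e2)"
proof -
  have E1: "e1 \<in> hom \<Sigma> a' c" "relevant e1" "\<And>q z. z \<in> hom \<Sigma> q a' \<Longrightarrow> asize z < asize (z ;; e1)"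
    and E2: "e2 \<in> hom \<Sigma> b' c" "relevant e2" "\<And>q z. z \<in> hom \<Sigma> q b' \<Longrightarrow> asize z < asize (z ;; e2)"
    using e1 e2 by (auto simp: elementary_def)
  have xs: "x ;; s \<in> hom \<Sigma> q a'" and yu: "y ;; u \<in> hom \<Sigma> q b'"
    using x y s u by (auto intro: seq_hom)
  have eq': "(y ;; u) ;; e2 = (x ;; s) ;; e1"
    using eq seq_assoc[OF x s(1) E1(1)] seq_assoc[OF y u(1) E2(1)] by simp
  have N': "asize ((x ;; s) ;; e1) \<le> N"
    using N seq_assoc[OF x s(1) E1(1)] by simp
  obtain p where pb: "is_pb \<Sigma> a' b' c p e1 e2 v1 t1"
    using gen_is_pb_typed[OF cell E1(1) E2(1)] .
  note vt = is_pb_homD(3,4)[OF pb]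
  have rel: "relevant v1" "relevant t1"
    using is_pb_relevant[OF pb E1(2) E2(2)] is_pb_relevant[OF is_pb_sym[OF pb] E2(2) E1(2)] by auto
  obtain h where h: "h \<in> hom \<Sigma> q p" "h ;; v1 = x ;; s" "h ;; t1 = y ;; u"
    using is_pb_factor[OF pb xs yu eq'] .
  \<comment> \<open>Both elementary factors are cut off the same common value, so both remainders
    lie below \<open>N\<close>.\<close>
  have small: "asize (x ;; s) < N" "asize (h ;; t1) < N"
    using E1(3)[OF xs] E2(3)[OF yu] N' eq' h by auto
  \<comment> \<open>\<open>h\<close> is the value in the last subproblem; it is bounded by
    \<open>h ;; v1 = x ;; s\<close> because \<open>v1\<close> is relevant.\<close>
  then have "asize h < N"
    using asize_seq_mono[OF h(1) vt(1) rel(1)] h(2) by simp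
  obtain v2 t2 p2 h2 where c2: "(s, v1, v2, t2) \<in> gen \<Sigma>" "v2 \<in> hom \<Sigma> p2 a" "t2 \<in> hom \<Sigma> p2 p"
    "relevant t2" "h2 \<in> hom \<Sigma> q p2" "h2 ;; t2 = h"
    using completable_belowE[OF below s(1) vt(1) s(2) rel(1) x h(1,2) small(1)] .
  obtain v3 t3 p3 h3 where c3: "(t1, u, v3, t3) \<in> gen \<Sigma>" "v3 \<in> hom \<Sigma> p3 p" "t3 \<in> hom \<Sigma> p3 b"
    "relevant v3" "h3 \<in> hom \<Sigma> q p3" "h3 ;; v3 = h"
    using completable_belowE[OF below vt(2) u(1) rel(2) u(2) h(1) y h(3)[symmetric] small(2)] .
  \<comment> \<open>The far corner completes \<open>t2\<close> and \<open>v3\<close> over the apex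
    \<open>p\<close>; \<open>h2\<close> and \<open>h3\<close> form a cone there with value
    \<open>h\<close>.\<close>
  obtain v4 t4 where c4: "(t2, v3, v4, t4) \<in> gen \<Sigma>"
    using completable_belowE[OF below c2(3) c3(2) c2(4) c3(4) c2(5) c3(5)] c2(6) c3(6) \<open>asize h < N\<close>
    by metis
  show ?thesis
    unfolding completable_def
    using gen_vcomp[OF gen_hcomp[OF cell c2(1)] gen_hcomp[OF c3(1) c4]] by blast
qed

section \<open>Elementary factors at chosen target positions\<close>

definition select :: "nat list \<Rightarrow> 'f arrow \<Rightarrow> 'f arrow" where
  "select is a = Arrow (src a) (map (\<lambda>i. comps a ! i) is)"

lemma select_hom: "a \<in> hom \<Sigma> n m \<Longrightarrow> set is \<subseteq> {..<m} \<Longrightarrow> select is a \<in> hom \<Sigma> n (length is)"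
  by (auto simp: select_def hom_def subset_eq)

lemma select_append: "select (is @ js) a = pairing (select is a) (select js a)"
  by (simp add: select_def pairing_def)

lemma seq_Vars: "a ;; Arrow m (map Var is) = select is a"
  by (simp add: seq_def select_def)

text \<open>\<open>L\<close> lists target positions at which \<open>s\<close> and \<open>u\<close>
  factor through \<open>e1\<close> and \<open>e2\<close>. A permutation moves them to the front,
  \<open>ident r\<close> carries the other positions along, the grid applies, and the permutation is
  undone.\<close>

lemma completable_peel:
  assumes below: "completable_below \<Sigma> q (asize (x ;; s))"
    and s: "s \<in> hom \<Sigma> a c" "relevant s" and u: "u \<in> hom \<Sigma> b c" "relevant u"
    and x: "x \<in> hom \<Sigma> q a" and y: "y \<in> hom \<Sigma> q b" and eq: "y ;; u = x ;; s"
    and L: "distinct L" "set L \<subseteq> {..<c}"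
    and cell: "(e1, e2, v1, t1) \<in> gen \<Sigma>"
    and e1: "elementary \<Sigma> e1 a' (length L)" and e2: "elementary \<Sigma> e2 b' (length L)"
    and z: "z \<in> hom \<Sigma> a a'" "select L s = z ;; e1" and w: "w \<in> hom \<Sigma> b b'" "select L u = w ;; e2"
  shows "completable \<Sigma> s u"
proof -
  define M where "M = filter (\<lambda>i. i \<notin> set L) [0..<c]"
  define r where "r = length M"
  let ?p = "Arrow c (map Var (L @ M))"
  have "distinct (L @ M)" "set (L @ M) = {..<c}"
    using L by (auto simp: M_def)
  then obtain k where k: "gen_iso \<Sigma> c ?p k"
    by (rule gen_iso_permutation)
  note p = gen_isoD(1-4)[OF k]
  have M: "set M \<subseteq> {..<c}" by (auto simp: M_def)
  have E: "e1 \<in> hom \<Sigma> a' (length L)" "e2 \<in> hom \<Sigma> b' (length L)"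
    using e1 e2 by (auto simp: elementary_def)
  let ?s = "pairing z (select M s)" and ?u = "pairing w (select M u)"
  let ?e1 = "e1 \<otimes> ident r" and ?e2 = "e2 \<otimes> ident r"
  have E': "elementary \<Sigma> ?e1 (a' + r) (length L + r)" "elementary \<Sigma> ?e2 (b' + r) (length L + r)"
    using e1 e2 by (auto intro: elementary_tensor_ident)
  then have Eh: "?e1 \<in> hom \<Sigma> (a' + r) (length L + r)" "?e2 \<in> hom \<Sigma> (b' + r) (length L + r)"
    by (auto simp: elementary_def)
  have Ms: "select M s \<in> hom \<Sigma> a r" "select M u \<in> hom \<Sigma> b r"
    using select_hom[OF s(1) M] select_hom[OF u(1) M] by (auto simp: r_def)
  have sh: "?s \<in> hom \<Sigma> a (a' + r)" "?u \<in> hom \<Sigma> b (b' + r)"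
    using z w Ms by (auto intro: pairing_hom)
  have sp: "s ;; ?p = ?s ;; ?e1" "u ;; ?p = ?u ;; ?e2"
    unfolding seq_Vars select_append
    using pairing_tensor[OF z(1) Ms(1) E(1) ident_hom] pairing_tensor[OF w(1) Ms(2) E(2) ident_hom]
      z(2) w(2) seq_ident[OF Ms(1)] seq_ident[OF Ms(2)] by simp_all
  have cancel: "(d ;; ?p) ;; k = d" if "d \<in> hom \<Sigma> i c" for d i
    using seq_assoc[OF that p(1,2)] p(3) seq_ident[OF that] by simp
  \<comment> \<open>Postcomposing with \<open>k\<close> recovers \<open>s\<close> and
    \<open>u\<close>, and relevance passes to first factors.\<close>
  have "relevant (s ;; ?p)" "relevant (u ;; ?p)"
    using relevant_seqD[OF _ seq_hom[OF s(1) p(1)] p(2)] relevant_seqD[OF _ seq_hom[OF u(1) p(1)] p(2)]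
      cancel[OF s(1)] cancel[OF u(1)] s(2) u(2) by simp_all
  then have rel: "relevant ?s" "relevant ?u"
    using relevant_seqD sp sh Eh by metis+
  have xs: "x ;; s \<in> hom \<Sigma> q c"
    using x s by (auto intro: seq_hom)
  have xsp: "x ;; (s ;; ?p) = (x ;; s) ;; ?p" "y ;; (u ;; ?p) = (x ;; s) ;; ?p"
    using seq_assoc[OF x s(1) p(1)] seq_assoc[OF y u(1) p(1)] eq by simp_all
  \<comment> \<open>Permuting does not enlarge the value: the inverse \<open>k\<close> is relevant,
    and composing with it returns to \<open>x ;; s\<close>.\<close>
  have "asize ((x ;; s) ;; ?p) \<le> asize (((x ;; s) ;; ?p) ;; k)"
    by (rule asize_seq_mono[OF seq_hom[OF xs p(1)] p(2) relevant_gen_iso[OF gen_iso_sym[OF k]]])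
  then have size: "asize (x ;; (?s ;; ?e1)) \<le> asize (x ;; s)"
    using cancel[OF xs] xsp sp by simp
  have eq': "y ;; (?u ;; ?e2) = x ;; (?s ;; ?e1)"
    using xsp sp by simp
  have cell': "(?e1, ?e2, v1 \<otimes> ident r, t1 \<otimes> ident r) \<in> gen \<Sigma>"
    by (rule gen_tensor[OF cell generated.ident_h[OF ident_hom]])
  have "completable \<Sigma> (s ;; ?p) (u ;; ?p)"
    unfolding sp
    by (rule completable_grid[OF below cell' E' sh(1) rel(1) sh(2) rel(2) x y eq' size])
  then obtain v t where vt: "(s ;; ?p, u ;; ?p, v, t) \<in> gen \<Sigma>"
    by (auto simp: completable_def)
  obtain d where "is_pb \<Sigma> a b c d (s ;; ?p) (u ;; ?p) v t"
    using gen_is_pb_typed[OF vt seq_hom[OF s(1) p(1)] seq_hom[OF u(1) p(1)]] .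
  from gen_postcomp[OF vt seq_hom[OF s(1) p(1)] is_pb_homD(3)[OF this] gen_iso_sym[OF k]]
  show ?thesis
    using cancel[OF s(1)] cancel[OF u(1)] by (auto simp: completable_def)
qed

text \<open>If no component is an operation term and no two agree, the components are distinct
  variables, and relevance makes them exhaust the source.\<close>

lemma relevant_cases:
  assumes s: "s \<in> hom \<Sigma> n m" "relevant s"
  obtains (iso) k where "n = m" "gen_iso \<Sigma> n s k"
  | (op) i f ts where "i < m" "comps s ! i = App f ts"
  | (dup) i j where "i < m" "j < m" "i \<noteq> j" "comps s ! i = comps s ! j"
proof (cases "(\<exists>i<m. \<exists>f ts. comps s ! i = App f ts) \<or> (\<exists>i<m. \<exists>j<m. i \<noteq> j \<and> comps s ! i = comps s ! j)")
  case True
  then show ?thesis using op dup by blast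
next
  case False
  have len: "length (comps s) = m" "src s = n"
    using s by (auto simp: hom_def)
  have "\<exists>j. comps s ! i = Var j" if "i < m" for i
    using False that by (cases "comps s ! i") auto
  then obtain f where f: "\<And>i. i < m \<Longrightarrow> comps s ! i = Var (f i)"
    by metis
  define xs where "xs = map f [0..<m]"
  have xs: "s = Arrow n (map Var xs)"
    using f len by (cases s) (auto simp: xs_def intro!: nth_equalityI)
  have d: "distinct xs"
    unfolding xs_def distinct_map using False f by (auto intro!: inj_onI) metis
  have set: "set xs = {..<n}"
    using s(2) avars_hom[OF s(1)] len(2) unfolding relevant_def xs by (auto simp: avars_def)
  have "n = m"
    using distinct_card[OF d] set by (simp add: xs_def)
  then show ?thesis
    using iso gen_iso_permutation[OF d set, of \<Sigma>] xs by metis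
qed

lemma select_op:
  assumes s: "s \<in> hom \<Sigma> n m" and i: "i < m" "comps s ! i = App f ts"
  shows "f \<in> \<Sigma> (length ts)" "Arrow n ts \<in> hom \<Sigma> n (length ts)"
    "select [i] s = Arrow n ts ;; opr (length ts) f"
proof -
  have "is_trm \<Sigma> n (App f ts)"
    using s i by (metis (mono_tags, lifting) hom_def mem_Collect_eq nth_mem)
  then show "f \<in> \<Sigma> (length ts)" and t: "Arrow n ts \<in> hom \<Sigma> n (length ts)"
    by (auto simp: hom_def)
  show "select [i] s = Arrow n ts ;; opr (length ts) f"
    using s i by (simp add: seq_opr[OF t] select_def hom_def)
qed

lemma select_dup:
  assumes s: "s \<in> hom \<Sigma> n m" and i: "i < m" "comps s ! i = comps s ! j"
  shows "select [i] s \<in> hom \<Sigma> n 1" "select [i, j] s = select [i] s ;; dupl 1"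
proof -
  show t: "select [i] s \<in> hom \<Sigma> n 1"
    using select_hom[OF s, of "[i]"] i by simp
  show "select [i, j] s = select [i] s ;; dupl 1"
    unfolding seq_dupl[OF t] using i by (simp add: select_def pairing_def)
qed

text \<open>Each side that is not a permutation offers an operation at one position or a duplicator
  at two. Disjoint positions need only identity cells; every pattern of overlap has its own basic
  cell.\<close>

lemma completable_relevant:
  assumes "s \<in> hom \<Sigma> a c" "relevant s" "u \<in> hom \<Sigma> b c" "relevant u"
    "x \<in> hom \<Sigma> q a" "y \<in> hom \<Sigma> q b" "y ;; u = x ;; s"
  shows "completable \<Sigma> s u"
  using assms
proof (induction "asize (x ;; s)" arbitrary: a b c s u x y rule: less_induct)
  case less
  have below: "completable_below \<Sigma> q (asize (x ;; s))"
    unfolding completable_below_def using less.hyps by blast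
  note s = less.prems(1,2) and u = less.prems(3,4) and eq = less.prems(7)
  note peel = completable_peel[OF below less.prems]
  have val: "subst (\<lambda>i. comps y ! i) (comps u ! i) = subst (\<lambda>i. comps x ! i) (comps s ! i)"
    if "i < c" for i
    using that s(1) u(1) arg_cong[OF eq, of "\<lambda>a. comps a ! i"] by (simp add: seq_def hom_def)
  have dd: "dupl 1 \<in> hom \<Sigma> 1 2"
    using elementary_dupl by (auto simp: elementary_def)

  \<comment> \<open>\<open>g1\<close> is cut off \<open>s\<close> at \<open>L\<close> and
    \<open>g2\<close> off \<open>u\<close> at \<open>M\<close>; the corner is the tensor of the
    horizontal identity cell on \<open>g1\<close> with the vertical one on
    \<open>g2\<close>.\<close>
  have disjoint: "completable \<Sigma> s u"
    if L: "distinct (L @ M)" "set (L @ M) \<subseteq> {..<c}"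
      and g: "elementary \<Sigma> g1 a1 (length L)" "elementary \<Sigma> g2 a2 (length M)"
      and z: "z \<in> hom \<Sigma> a a1" "select L s = z ;; g1" and w: "w \<in> hom \<Sigma> b a2" "select M u = w ;; g2"
    for L M g1 g2 a1 a2 z w
  proof -
    have G: "g1 \<in> hom \<Sigma> a1 (length L)" "g2 \<in> hom \<Sigma> a2 (length M)"
      using g by (auto simp: elementary_def)
    have sM: "select M s \<in> hom \<Sigma> a (length M)" and uL: "select L u \<in> hom \<Sigma> b (length L)"
      using select_hom[OF s(1)] select_hom[OF u(1)] L by auto
    have cell: "(g1 \<otimes> ident (length M), ident (length L) \<otimes> g2, ident a1 \<otimes> g2, g1 \<otimes> ident a2) \<in> gen \<Sigma>"
      by (rule gen_tensor[OF generated.ident_h[OF G(1)] generated.ident_v[OF G(2)]])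
    show ?thesis
    proof (rule peel[OF L cell])
      show "elementary \<Sigma> (g1 \<otimes> ident (length M)) (a1 + length M) (length (L @ M))"
        "elementary \<Sigma> (ident (length L) \<otimes> g2) (length L + a2) (length (L @ M))"
        using elementary_tensor_ident[OF g(1)] elementary_ident_tensor[OF g(2)] by simp_all
      show "pairing z (select M s) \<in> hom \<Sigma> a (a1 + length M)"
        "pairing (select L u) w \<in> hom \<Sigma> b (length L + a2)"
        using z w sM uL by (auto intro: pairing_hom)
      show "select (L @ M) s = pairing z (select M s) ;; (g1 \<otimes> ident (length M))"
        using pairing_tensor[OF z(1) sM G(1) ident_hom] seq_ident[OF sM] z(2)
        by (simp add: select_append)
      show "select (L @ M) u = pairing (select L u) w ;; (ident (length L) \<otimes> g2)"
        using pairing_tensor[OF uL w(1) ident_hom G(2)] seq_ident[OF uL] w(2)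
        by (simp add: select_append)
    qed
  qed

  have op_op: "completable \<Sigma> s u"
    if i: "i < c" "comps s ! i = App f ts" "comps u ! i = App g us" for i f g ts us
  proof -
    \<comment> \<open>The one place where symbols could clash; the cone excludes it through
      \<open>val\<close>.\<close>
    have fg: "g = f" "length us = length ts"
      using val[OF i(1)] i by (auto dest: map_eq_imp_length_eq)
    note S = select_op[OF s(1) i(1,2)] and U = select_op[OF u(1) i(1,3)]
    let ?n = "length ts"
    have cell: "(opr ?n f, opr ?n f, ident ?n, ident ?n) \<in> gen \<Sigma>"
      by (rule generated.basic) (use S(1) in \<open>auto simp: pullback_basis_def R_op_def\<close>)
    have "elementary \<Sigma> (opr ?n f) ?n (length [i])"
      using elementary_opr[of f \<Sigma> ?n] S(1) by simp
    then show ?thesis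
      using peel[OF _ _ cell _ _ S(2,3)] U(2,3) i(1) unfolding fg by auto
  qed

  \<comment> \<open>Only the operation at \<open>i\<close> is cut off \<open>s\<close>; the graph
    leg of \<open>D_op\<close> reintroduces it at position \<open>j\<close>, which \<open>u\<close>
    identifies with \<open>i\<close>.\<close>
  have op_dup: "completable \<Sigma> s u"
    if i: "i < c" "j < c" "i \<noteq> j" "comps s ! i = App f ts" "comps u ! i = comps u ! j" for i j f ts
  proof -
    note S = select_op[OF s(1) i(1,4)] and U = select_dup[OF u(1) i(1,5)]
    let ?n = "length ts"
    have sj: "select [j] s \<in> hom \<Sigma> a 1"
      using select_hom[OF s(1), of "[j]"] i by simp
    have e: "elementary \<Sigma> (opr ?n f) ?n 1"
      by (rule elementary_opr[of f \<Sigma> ?n, OF S(1)])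
    have cell: "(opr ?n f \<otimes> ident 1, dupl 1, dupl ?n ;; (ident ?n \<otimes> opr ?n f), opr ?n f) \<in> gen \<Sigma>"
      by (rule generated.basic) (use S(1) in \<open>auto simp: pullback_basis_def D_op_def\<close>)
    show ?thesis
    proof (rule peel[OF _ _ cell _ _ _ _ U(1)])
      show "elementary \<Sigma> (opr ?n f \<otimes> ident 1) (?n + 1) (length [i, j])"
        using elementary_tensor_ident[OF e, of 1] by (simp add: numeral_2_eq_2)
      show "elementary \<Sigma> (dupl 1) 1 (length [i, j])"
        using elementary_dupl by (simp add: numeral_2_eq_2)
      show "pairing (Arrow a ts) (select [j] s) \<in> hom \<Sigma> a (?n + 1)"
        by (rule pairing_hom[OF S(2) sj])
      show "select [i, j] s = pairing (Arrow a ts) (select [j] s) ;; (opr ?n f \<otimes> ident 1)"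
        using pairing_tensor[OF S(2) sj opr_hom[of f \<Sigma> ?n, OF S(1)] ident_hom] seq_ident[OF sj] S(3)
          select_append[of "[i]" "[j]" s] by simp
      show "select [i, j] u = select [i] u ;; dupl 1"
        by (rule U)
    qed (use i in auto)
  qed

  have dup_op: "completable \<Sigma> s u"
    if i: "i < c" "j < c" "i \<noteq> j" "comps u ! i = App f ts" "comps s ! i = comps s ! j" for i j f ts
  proof -
    note U = select_op[OF u(1) i(1,4)] and S = select_dup[OF s(1) i(1,5)]
    let ?n = "length ts"
    have uj: "select [j] u \<in> hom \<Sigma> b 1"
      using select_hom[OF u(1), of "[j]"] i by simp
    have e: "elementary \<Sigma> (opr ?n f) ?n 1"
      by (rule elementary_opr[of f \<Sigma> ?n, OF U(1)])
    have cell: "(dupl 1, opr ?n f \<otimes> ident 1, opr ?n f, dupl ?n ;; (ident ?n \<otimes> opr ?n f)) \<in> gen \<Sigma>"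
      by (rule generated.basic) (use U(1) in \<open>auto simp: pullback_basis_def D_hat_op_def\<close>)
    show ?thesis
    proof (rule peel[OF _ _ cell _ _ S(1)])
      show "elementary \<Sigma> (opr ?n f \<otimes> ident 1) (?n + 1) (length [i, j])"
        using elementary_tensor_ident[OF e, of 1] by (simp add: numeral_2_eq_2)
      show "elementary \<Sigma> (dupl 1) 1 (length [i, j])"
        using elementary_dupl by (simp add: numeral_2_eq_2)
      show "pairing (Arrow b ts) (select [j] u) \<in> hom \<Sigma> b (?n + 1)"
        by (rule pairing_hom[OF U(2) uj])
      show "select [i, j] u = pairing (Arrow b ts) (select [j] u) ;; (opr ?n f \<otimes> ident 1)"
        using pairing_tensor[OF U(2) uj opr_hom[of f \<Sigma> ?n, OF U(1)] ident_hom] seq_ident[OF uj] U(3)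
          select_append[of "[i]" "[j]" u] by simp
      show "select [i, j] s = select [i] s ;; dupl 1"
        by (rule S)
    qed (use i in auto)
  qed

  have dup_same: "completable \<Sigma> s u"
    if i: "i < c" "j < c" "i \<noteq> j" "comps s ! i = comps s ! j" "comps u ! i = comps u ! j" for i j
  proof -
    note S = select_dup[OF s(1) i(1,4)] and U = select_dup[OF u(1) i(1,5)]
    have cell: "(dupl 1, dupl 1, ident 1, ident 1) \<in> gen \<Sigma>"
      by (rule generated.basic) (auto simp: pullback_basis_def R_dupl_def)
    have e: "elementary \<Sigma> (dupl 1) 1 (length [i, j])"
      using elementary_dupl by (simp add: numeral_2_eq_2)
    show ?thesis
      by (rule peel[OF _ _ cell e e S U]) (use i in auto)
  qed

  \<comment> \<open>The shared position \<open>j\<close> stands in the middle, as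
    \<open>D_dupl\<close> requires: the left pair agrees in \<open>s\<close>, the right pair in
    \<open>u\<close>.\<close>
  have dup_overlap: "completable \<Sigma> s u"
    if i: "i < c" "j < c" "k < c" "distinct [i, j, k]" "comps s ! i = comps s ! j"
      "comps u ! j = comps u ! k" for i j k
  proof -
    note S = select_dup[OF s(1) i(1,5)] and U = select_dup[OF u(1) i(2,6)]
    have ui: "select [i] u \<in> hom \<Sigma> b 1" and sk: "select [k] s \<in> hom \<Sigma> a 1"
      using select_hom[OF u(1), of "[i]"] select_hom[OF s(1), of "[k]"] i by simp_all
    have cell: "(dupl 1 \<otimes> ident 1, ident 1 \<otimes> dupl 1, dupl 1, dupl 1) \<in> gen \<Sigma>"
      by (rule generated.basic) (auto simp: pullback_basis_def D_dupl_def)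
    show ?thesis
    proof (rule peel[OF i(4) _ cell])
      show "set [i, j, k] \<subseteq> {..<c}" using i by auto
      show "elementary \<Sigma> (dupl 1 \<otimes> ident 1) (1 + 1) (length [i, j, k])"
        "elementary \<Sigma> (ident 1 \<otimes> dupl 1) (1 + 1) (length [i, j, k])"
        using elementary_tensor_ident[OF elementary_dupl, of \<Sigma> 1]
          elementary_ident_tensor[OF elementary_dupl, of \<Sigma> 1]
        by (simp_all add: numeral_3_eq_3)
      show "pairing (select [i] s) (select [k] s) \<in> hom \<Sigma> a (1 + 1)"
        "pairing (select [i] u) (select [j] u) \<in> hom \<Sigma> b (1 + 1)"
        by (rule pairing_hom[OF S(1) sk] pairing_hom[OF ui U(1)])+
      show "select [i, j, k] s = pairing (select [i] s) (select [k] s) ;; (dupl 1 \<otimes> ident 1)"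
        using pairing_tensor[OF S(1) sk dd ident_hom] seq_ident[OF sk] S(2)
          select_append[of "[i, j]" "[k]" s] by simp
      show "select [i, j, k] u = pairing (select [i] u) (select [j] u) ;; (ident 1 \<otimes> dupl 1)"
        using pairing_tensor[OF ui U(1) ident_hom dd] seq_ident[OF ui] U(2)
          select_append[of "[i]" "[j, k]" u] by simp
    qed
  qed

  have op1: "elementary \<Sigma> (opr (length ts) f) (length ts) (length [i])"
    if "f \<in> \<Sigma> (length ts)" for f ts and i :: nat
    using elementary_opr[of f \<Sigma> "length ts", OF that] by simp
  have dup2: "elementary \<Sigma> (dupl 1) 1 (length [i, j])" for i j :: nat
    using elementary_dupl by (simp add: numeral_2_eq_2)

  from s show ?case
  proof (cases rule: relevant_cases)
    case (iso k)
    then show ?thesis using gen_iso_left u(1) unfolding completable_def by blast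
  next
    case s_op: (op i f ts)
    note S = select_op[OF s(1) s_op]
    from u show ?thesis
    proof (cases rule: relevant_cases)
      case (iso k)
      then show ?thesis using gen_iso_right s(1) unfolding completable_def by blast
    next
      case (op j g us)
      note U = select_op[OF u(1) op]
      show ?thesis
      proof (cases "i = j")
        case True
        then show ?thesis using op_op s_op op by blast
      next
        case False
        then show ?thesis
          by (intro disjoint[OF _ _ op1[OF S(1)] op1[OF U(1)] S(2,3) U(2,3)]) (use s_op op in auto)
      qed
    next
      case (dup j k)
      note U = select_dup[OF u(1) dup(1,4)]
      consider "i = j" | "i = k" | "i \<noteq> j" "i \<noteq> k" by blast
      then show ?thesis
      proof cases
        case 1
        then show ?thesis using op_dup[of j k f ts] s_op dup by blast
      next
        case 2
        then show ?thesis using op_dup[of k j f ts] s_op dup by metis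
      next
        case 3
        then show ?thesis
          by (intro disjoint[OF _ _ op1[OF S(1)] dup2 S(2,3) U]) (use s_op dup in auto)
      qed
    qed
  next
    case s_dup: (dup i j)
    note S = select_dup[OF s(1) s_dup(1,4)]
    from u show ?thesis
    proof (cases rule: relevant_cases)
      case (iso k)
      then show ?thesis using gen_iso_right s(1) unfolding completable_def by blast
    next
      case (op k g us)
      note U = select_op[OF u(1) op]
      consider "i = k" | "j = k" | "i \<noteq> k" "j \<noteq> k" by blast
      then show ?thesis
      proof cases
        case 1
        then show ?thesis using dup_op[of i j g us] s_dup op by blast
      next
        case 2
        then show ?thesis using dup_op[of j i g us] s_dup op by metis
      next
        case 3
        then show ?thesis
          by (intro disjoint[OF _ _ dup2 op1[OF U(1)] S U(2,3)]) (use s_dup op in auto)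
      qed
    next
      case (dup k l)
      note U = select_dup[OF u(1) dup(1,4)]
      \<comment> \<open>The pairs are equal, share exactly one index in one of four ways, or are
        disjoint. A single shared index becomes the middle argument of
        \<open>dup_overlap\<close>.\<close>
      consider "{i, j} = {k, l}" | "i = k" "j \<noteq> l" | "i = l" "j \<noteq> k" | "j = k" "i \<noteq> l"
        | "j = l" "i \<noteq> k" | "distinct [i, j, k, l]"
        using s_dup(3) dup(3) by (auto simp: doubleton_eq_iff)
      then show ?thesis
      proof cases
        case 1
        then show ?thesis using dup_same[of i j] s_dup dup by (metis doubleton_eq_iff)
      next
        case 2
        then show ?thesis using dup_overlap[of j i l] s_dup dup by auto
      next
        case 3
        then show ?thesis using dup_overlap[of j i k] s_dup dup by auto
      next
        case 4
        then show ?thesis using dup_overlap[of i j l] s_dup dup by auto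
      next
        case 5
        then show ?thesis using dup_overlap[of i j k] s_dup dup by auto
      next
        case 6
        then show ?thesis
          by (intro disjoint[OF _ _ dup2 dup2 S U]) (use s_dup dup in auto)
      qed
    qed
  qed
qed


subsection \<open>Arbitrary cospans\<close>

lemma is_trm_subst_tvars:
  "is_trm \<Sigma> n t \<Longrightarrow> (\<And>i. i \<in> tvars t \<Longrightarrow> is_trm \<Sigma> m (\<sigma> i)) \<Longrightarrow> is_trm \<Sigma> m (subst \<sigma> t)"
  by (induction t) auto

text \<open>The occurring variables \<open>vs\<close> are moved before the others,
  \<open>ws\<close>, and \<open>s'\<close> is \<open>s\<close> renamed along \<open>vs\<close>;
  \<open>Arrow r []\<close> is the discharger from \<open>r\<close> to the terminal object
  0.\<close>

lemma relevant_factorization: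
  assumes s: "s \<in> hom \<Sigma> n m"
  obtains h k s' d r where "gen_iso \<Sigma> n h k" "s' \<in> hom \<Sigma> d m" "relevant s'" "n = d + r"
    "s = h ;; (s' \<otimes> Arrow r [])"
proof -
  define vs where "vs = filter (\<lambda>i. i \<in> avars s) [0..<n]"
  define ws where "ws = filter (\<lambda>i. i \<notin> avars s) [0..<n]"
  define d where "d = length vs"
  have vs: "set vs = avars s" "distinct vs"
    using avars_hom[OF s] by (auto simp: vs_def)
  have perm: "distinct (vs @ ws)" "set (vs @ ws) = {..<n}"
    by (auto simp: vs_def ws_def)
  then obtain k where k: "gen_iso \<Sigma> n (Arrow n (map Var (vs @ ws))) k"
    by (rule gen_iso_permutation)
  have "n = length (vs @ ws)"
    using distinct_card[OF perm(1)] perm(2) by simp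
  then have n: "n = d + length ws"
    by (simp add: d_def)
  have "\<exists>j<d. vs ! j = i" if "i \<in> avars s" for i
    using that vs by (auto simp: in_set_conv_nth d_def)
  \<comment> \<open>\<open>pos i\<close> is the new index of the occurring variable
    \<open>i\<close>.\<close>
  then obtain pos where pos: "\<And>i. i \<in> avars s \<Longrightarrow> pos i < d \<and> vs ! pos i = i"
    by metis
  define s' where "s' = Arrow d (map (subst (\<lambda>i. Var (pos i))) (comps s))"
  have sub: "tvars t \<subseteq> avars s" if "t \<in> set (comps s)" for t
    using that by (auto simp: avars_def)
  have s'_hom: "s' \<in> hom \<Sigma> d m"
    using s pos sub by (fastforce simp: hom_def s'_def intro!: is_trm_subst_tvars)
  have "j \<in> avars s'" if j: "j < d" for j
  proof -
    have *: "vs ! j \<in> avars s"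
      unfolding vs(1)[symmetric] using j by (simp add: d_def)
    then obtain t where t: "t \<in> set (comps s)" "vs ! j \<in> tvars t"
      by (auto simp: avars_def)
    have "pos (vs ! j) = j"
      using pos[OF *] j nth_eq_iff_index_eq[OF vs(2)] unfolding d_def by blast
    then show ?thesis
      using t by (force simp: avars_def s'_def tvars_subst)
  qed
  then have rel: "relevant s'"
    by (auto simp: relevant_def s'_def)
  have "subst (\<lambda>i. map Var (vs @ ws) ! i) (subst (\<lambda>i. Var (pos i)) t) = t" if t: "t \<in> set (comps s)" for t
  proof -
    have "subst (\<lambda>i. map Var (vs @ ws) ! i) (subst (\<lambda>i. Var (pos i)) t) = subst Var t"
      unfolding subst_subst
    proof (rule subst_cong_tvars)
      fix i assume "i \<in> tvars t"
      then have "pos i < d" "vs ! pos i = i" using pos sub[OF t] by auto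
      then show "subst (\<lambda>i. map Var (vs @ ws) ! i) (Var (pos i)) = Var i"
        by (simp add: d_def nth_append)
    qed
    then show ?thesis by (simp add: subst_Var)
  qed
  then have "s = Arrow n (map Var (vs @ ws)) ;; (s' \<otimes> Arrow (length ws) [])"
    using s by (cases s) (simp add: seq_def tensor_def s'_def hom_def map_idI del: map_append)
  then show ?thesis
    using that[OF k s'_hom rel n] by blast
qed

lemma discharger_hom: "Arrow r [] \<in> hom \<Sigma> r 0"
  by (simp add: hom_def)

text \<open>The part of \<open>x\<close> that feeds the discharger leaves no trace, so a cone over
  the full cospan restricts to one over its relevant part.\<close>

lemma seq_tensor_discharger:
  assumes x: "x \<in> hom \<Sigma> q (d + r)" and s: "s \<in> hom \<Sigma> d m"
  obtains y where "y \<in> hom \<Sigma> q d" "x ;; (s \<otimes> Arrow r []) = y ;; s"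
proof -
  obtain y z where y: "y \<in> hom \<Sigma> q d" "z \<in> hom \<Sigma> q r" "x = pairing y z"
    using pairing_cases[OF x] .
  have "x ;; (s \<otimes> Arrow r []) = pairing (y ;; s) (z ;; Arrow r [])"
    using pairing_tensor[OF y(1,2) s discharger_hom] y(3) by simp
  also have "\<dots> = y ;; s"
    by (simp add: pairing_def seq_def)
  finally show ?thesis
    using that y(1) by blast
qed

lemma completable_cospan:
  assumes s: "s \<in> hom \<Sigma> a c" and u: "u \<in> hom \<Sigma> b c" and x: "x \<in> hom \<Sigma> q a" and y: "y \<in> hom \<Sigma> q b"
    and eq: "y ;; u = x ;; s"
  shows "completable \<Sigma> s u"
proof -
  obtain h k s' d r where h: "gen_iso \<Sigma> a h k" and s': "s' \<in> hom \<Sigma> d c" "relevant s'"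
    and a: "a = d + r" and s_eq: "s = h ;; (s' \<otimes> Arrow r [])"
    using relevant_factorization[OF s] .
  obtain h' k' u' d' r' where h': "gen_iso \<Sigma> b h' k'" and u': "u' \<in> hom \<Sigma> d' c" "relevant u'"
    and b: "b = d' + r'" and u_eq: "u = h' ;; (u' \<otimes> Arrow r' [])"
    using relevant_factorization[OF u] .
  have S: "s' \<otimes> Arrow r [] \<in> hom \<Sigma> a c" and U: "u' \<otimes> Arrow r' [] \<in> hom \<Sigma> b c"
    using tensor_hom[OF s'(1) discharger_hom] tensor_hom[OF u'(1) discharger_hom] a b by simp_all
  obtain x' where x': "x' \<in> hom \<Sigma> q d" "x ;; s = x' ;; s'"
    using seq_tensor_discharger[OF seq_hom[OF x gen_isoD(1)[OF h], unfolded a] s'(1)]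
      seq_assoc[OF x gen_isoD(1)[OF h] S] s_eq by metis
  obtain y' where y': "y' \<in> hom \<Sigma> q d'" "y ;; u = y' ;; u'"
    using seq_tensor_discharger[OF seq_hom[OF y gen_isoD(1)[OF h'], unfolded b] u'(1)]
      seq_assoc[OF y gen_isoD(1)[OF h'] U] u_eq by metis
  have "completable \<Sigma> s' u'"
    using completable_relevant[OF s' u' x'(1) y'(1)] x'(2) y'(2) eq by simp
  then obtain v t where vt: "(s', u', v, t) \<in> gen \<Sigma>"
    by (auto simp: completable_def)
  \<comment> \<open>Over the terminal object the pullback is the product \<open>r + r'\<close> with
    its projections, here as a tensor of two identity cells.\<close>
  have "(Arrow r [], Arrow r' [], ident r \<otimes> Arrow r' [], Arrow r [] \<otimes> ident r') \<in> gen \<Sigma>"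
    using gen_tensor[OF generated.ident_h[OF discharger_hom] generated.ident_v[OF discharger_hom]]
    by (metis ident_0_tensor tensor_ident_0)
  from gen_tensor[OF vt this] obtain V T where VT: "(s' \<otimes> Arrow r [], u' \<otimes> Arrow r' [], V, T) \<in> gen \<Sigma>"
    by blast
  obtain p where "is_pb \<Sigma> a b c p (s' \<otimes> Arrow r []) (u' \<otimes> Arrow r' []) V T"
    using gen_is_pb_typed[OF VT S U] .
  note hom = is_pb_homD(3,4)[OF this]
  have "(s, u' \<otimes> Arrow r' [], V ;; k, T) \<in> gen \<Sigma>"
    unfolding s_eq by (rule gen_left_precomp[OF VT hom h])
  from gen_right_precomp[OF this seq_hom[OF hom(1) gen_isoD(2)[OF h]] hom(2) h']
  show ?thesis
    by (auto simp: completable_def u_eq)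
qed

theorem theorem3p10:
  fixes \<Sigma> :: "'f signature" and o0 o1 o2 o3 :: nat and s u v t :: "'f arrow"
  assumes "s \<in> hom \<Sigma> o1 o0" and "u \<in> hom \<Sigma> o2 o0"
    and "v \<in> hom \<Sigma> o3 o1" and "t \<in> hom \<Sigma> o3 o2"
    and "t ;; u = v ;; s"
  shows "(s, u, v, t) \<in> generated \<Sigma> (pullback_basis \<Sigma>) \<longleftrightarrow> is_pullback \<Sigma> s u o3 v t"
proof
  assume "(s, u, v, t) \<in> gen \<Sigma>"
  then obtain p where pb: "is_pb \<Sigma> o1 o2 o0 p s u v t"
    using assms(1,2) by (rule gen_is_pb_typed)
  then have "p = o3"
    using is_pb_homD(3)[OF pb] hom_unique[OF assms(3)] by blast
  with pb show "is_pullback \<Sigma> s u o3 v t"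
    by (auto simp: is_pullback_iff)
next
  assume "is_pullback \<Sigma> s u o3 v t"
  then obtain a b c where "is_pb \<Sigma> a b c o3 s u v t"
    by (auto simp: is_pullback_iff)
  moreover from this have "a = o1" "b = o2" "c = o0"
    using is_pb_homD(1,2) hom_unique assms(1,2) by metis+
  ultimately have pb: "is_pb \<Sigma> o1 o2 o0 o3 s u v t"
    by simp
  \<comment> \<open>The given square itself serves as the cone, with \<open>q = o3\<close>.\<close>
  obtain v0 t0 where gen: "(s, u, v0, t0) \<in> gen \<Sigma>"
    using completable_cospan[OF assms] by (auto simp: completable_def)
  obtain p where pb0: "is_pb \<Sigma> o1 o2 o0 p s u v0 t0"
    using gen_is_pb_typed[OF gen assms(1,2)] .
  note hom0 = is_pb_homD[OF pb0]
  obtain h where h: "h \<in> hom \<Sigma> o3 p" "h ;; v0 = v" "h ;; t0 = t"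
    using is_pb_factor[OF pb0 assms(3-5)] .
  obtain k where k: "k \<in> hom \<Sigma> p o3" "k ;; v = v0" "k ;; t = t0"
    using is_pb_factor[OF pb hom0(3-5)] .
  have "h ;; k = ident o3"
    using is_pb_unique[OF pb seq_hom[OF h(1) k(1)] ident_hom]
      seq_assoc[OF h(1) k(1) assms(3)] seq_assoc[OF h(1) k(1) assms(4)] h k
      ident_seq[OF assms(3)] ident_seq[OF assms(4)] by simp
  moreover have "k ;; h = ident p"
    using is_pb_unique[OF pb0 seq_hom[OF k(1) h(1)] ident_hom]
      seq_assoc[OF k(1) h(1) hom0(3)] seq_assoc[OF k(1) h(1) hom0(4)] h k
      ident_seq[OF hom0(3)] ident_seq[OF hom0(4)] by simp
  ultimately obtain l where "p = o3" "gen_iso \<Sigma> o3 h l"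
    using gen_iso_inverse_arrows[OF h(1) k(1)] by blast
  \<comment> \<open>The comparison \<open>h\<close> is a permutation, so its cell carries the
    generated legs \<open>v0\<close>, \<open>t0\<close> to \<open>v\<close>,
    \<open>t\<close>.\<close>
  then show "(s, u, v, t) \<in> gen \<Sigma>"
    using gen_precomp[OF gen hom0(2,4)] gen_isoD(5) h(2,3) by metis
qed

end
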